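(* Let $L_1,L_2,C_1,C_2,R>0$ and let $V_{\mathrm{in}}$ be a real constant. Let $A(\cdot)$ and $B$ be as in the context, and let $\epsilon,T$ satisfy $0<2\epsilon\le T<\pi\sqrt{L_1C_1}$. Then, for all $\mu\in\mathbb{PWM}(T,\epsilon)$, we have that: (a) there exist positive constants $K$ and $\lambda$ so that for every initial condition $x(0)\in\mathbb{R}^4$ and all $t\ge0$, the trajectories of $\dot x(t)=A(\mu(t))x(t)$ satisfy $$\|x(t)\|\le K\|x(0)\|e^{-\lambda t};$$ (b) there exist positive constants $K$, $\lambda$ and $G$ such that for every initial condition $x(0)\in\mathbb{R}^4$ and all $t\ge0$, the trajectories of $\dot x(t)=A(\mu(t))x(t)+Bu(t)$, with $u(\cdot)$ an arbitrary (scalar) perturbation input, satisfy $$\|x(t)\|\le K\|x(0)\|e^{-\lambda t}+G\sup_{0\le\tau\le t}\|u(\tau)\| ;$$ (c) the trajectories of $\dot x(t)=A(\mu(t))x(t)+B\mu(t)$ satisfy, for all $t\ge0$, $$\|x(t)\|\le K\|x(0)\|e^{-\lambda t}+\frac{G}{2},$$ with the same $K$, $\lambda$ and $G$ as in (b).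
   Context: $M'$ denotes the transpose of $M$, and $\|\cdot\|$ the Euclidean norm on vectors (absolute value on scalars). Matrices: $P:=\frac12\operatorname{diag}(L_1,L_2,C_1,C_2)$; for $\mu\in[-0.5,0.5]$, $$A(\mu):=\tfrac12P^{-1}\left(A_0^q+\mu E_0^q\right),\qquad A_0^q=\begin{bmatrix}0&0&-0.5&0\\0&0&0.5&1\\0.5&-0.5&0&0\\0&-1&0&-1/R\end{bmatrix},\qquad E_0^q=\begin{bmatrix}0&0&1&0\\0&0&1&0\\-1&-1&0&0\\0&0&0&0\end{bmatrix};$$ $$B:=\tfrac12P^{-1}\,[\,2V_{\mathrm{in}}\ \ 2V_{\mathrm{in}}\ \ 0\ \ 0\,]'.$$ Switching signals: for $0<2\epsilon\le T$, a signal $\mu:\mathbb{R}\to\{-0.5,0.5\}$ is of class $\mathbb{PWM}(T,\epsilon)$ if it is right-continuous and for every integer $k$ there is a time $t_k$ with $kT+\epsilon\le t_k\le(k+1)T-\epsilon$ such that $\mu(t)=0.5$ for $kT\le t<t_k$ and $\mu(t)=-0.5$ for $t_k\le t<(k+1)T$. A trajectory is a locally absolutely continuous function $x:[0,\infty)\to\mathbb{R}^4$ satisfying the stated differential equation for almost every $t\ge 0$. (The system $\dot x=A(\mu)x+B\mu$ with $\mu\in\{-0.5,0.5\}$ is the switched model of a semi-quasi-Z-source inverter with resistive load $R$.) *)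

theory Defs
  imports "HOL-Analysis.Analysis"
begin

definition diag_mat :: "'a::zero ^ 'n \<Rightarrow> 'a ^ 'n ^ 'n" where
  "diag_mat v = (\<chi> i j. if i = j then v $ i else 0)"

definition P_mat :: "real \<Rightarrow> real \<Rightarrow> real \<Rightarrow> real \<Rightarrow> real ^ 4 ^ 4" where
  "P_mat L1 L2 C1 C2 = (1/2) *\<^sub>R diag_mat (vector [L1, L2, C1, C2])"

text \<open>In \<open>vector [...] :: real ^ 4 ^ 4\<close> the inner vectors are the rows of the matrix.\<close>

definition A0q :: "real \<Rightarrow> real ^ 4 ^ 4" where
  "A0q R = vector
     [vector [  0,    0, -1/2,    0],
      vector [  0,    0,  1/2,    1],
      vector [1/2, -1/2,    0,    0],
      vector [  0,   -1,    0, -1/R]]"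

definition E0q :: "real ^ 4 ^ 4" where
  "E0q = vector
     [vector [ 0,  0, 1, 0],
      vector [ 0,  0, 1, 0],
      vector [-1, -1, 0, 0],
      vector [ 0,  0, 0, 0]]"

definition A_mat :: "real \<Rightarrow> real \<Rightarrow> real \<Rightarrow> real \<Rightarrow> real \<Rightarrow> real \<Rightarrow> real ^ 4 ^ 4" where
  "A_mat L1 L2 C1 C2 R m =
     (1/2) *\<^sub>R (matrix_inv (P_mat L1 L2 C1 C2) ** (A0q R + m *\<^sub>R E0q))"

definition B_vec :: "real \<Rightarrow> real \<Rightarrow> real \<Rightarrow> real \<Rightarrow> real \<Rightarrow> real ^ 4" where
  "B_vec L1 L2 C1 C2 Vin =
     (1/2) *\<^sub>R (matrix_inv (P_mat L1 L2 C1 C2) *v vector [2 * Vin, 2 * Vin, 0, 0])"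

text \<open>Used only for \<open>0 < 2 * \<epsilon> \<le> T\<close>.\<close>

definition PWM :: "real \<Rightarrow> real \<Rightarrow> (real \<Rightarrow> real) set" where
  "PWM T \<epsilon> = {\<mu>.
     (\<forall>t. \<mu> t \<in> {-1/2, 1/2}) \<and>
     (\<forall>t. continuous (at_right t) \<mu>) \<and>
     (\<forall>k::int. \<exists>tk. of_int k * T + \<epsilon> \<le> tk \<and> tk \<le> (of_int k + 1) * T - \<epsilon> \<and>
        (\<forall>t. of_int k * T \<le> t \<and> t < tk \<longrightarrow> \<mu> t = 1/2) \<and>
        (\<forall>t. tk \<le> t \<and> t < (of_int k + 1) * T \<longrightarrow> \<mu> t = -1/2))}"

text \<open>The classical \<open>\<epsilon>\<close>-\<open>\<delta>\<close> notion; a pair \<open>(c, d)\<close> in \<open>D\<close> stands for the interval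
  \<open>{c<..<d}\<close>.\<close>

definition abs_cont_on_interval :: "real \<Rightarrow> real \<Rightarrow> (real \<Rightarrow> 'a::real_normed_vector) \<Rightarrow> bool" where
  "abs_cont_on_interval a b f \<longleftrightarrow>
     (\<forall>e>0. \<exists>\<delta>>0. \<forall>D. finite D \<longrightarrow>
        (\<forall>(c, d)\<in>D. a \<le> c \<and> c < d \<and> d \<le> b) \<longrightarrow>
        disjoint_family_on (\<lambda>(c, d). {c<..<d}) D \<longrightarrow>
        (\<Sum>(c, d)\<in>D. d - c) < \<delta> \<longrightarrow>
        (\<Sum>(c, d)\<in>D. norm (f d - f c)) < e)"

text \<open>Functions on \<open>[0,\<infinity>)\<close> are total functions on \<open>real\<close> of which only the values on
  \<open>{0..}\<close> matter.\<close>

definition locally_abs_cont :: "(real \<Rightarrow> 'a::real_normed_vector) \<Rightarrow> bool" where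
  "locally_abs_cont f \<longleftrightarrow> (\<forall>a b. 0 \<le> a \<and> a \<le> b \<longrightarrow> abs_cont_on_interval a b f)"

definition trajectory :: "(real \<Rightarrow> 'a \<Rightarrow> 'a) \<Rightarrow> (real \<Rightarrow> 'a::real_normed_vector) \<Rightarrow> bool" where
  "trajectory f x \<longleftrightarrow> locally_abs_cont x \<and>
     (AE t in lebesgue. 0 \<le> t \<longrightarrow> (x has_vector_derivative f t (x t)) (at t within {0..}))"

end

theory Submission
  imports Defs
begin

text \<open>
  The stored energy \<open>V = x' P x\<close> dissipates only through the load resistor,
  \<open>V' = - x\<^sub>4\<^sup>2 / R\<close> for zero input, so the point is to show that over two switching periods a fixed
  fraction of \<open>V\<close> passes through \<open>x\<^sub>4\<close>. In mode \<open>\<mu> = 1/2\<close> the states \<open>x\<^sub>2, x\<^sub>3, x\<^sub>4\<close> form an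
  observable chain with output \<open>x\<^sub>4\<close>. In mode \<open>\<mu> = -1/2\<close> the pair \<open>(x\<^sub>1, x\<^sub>3)\<close> is an undamped
  oscillator of half-period \<open>\<pi> \<surd>(L\<^sub>1 C\<^sub>1) > T\<close>, so the values of \<open>x\<^sub>3\<close> at both ends of that mode
  determine \<open>x\<^sub>1\<close>; each of them is an endpoint value of a neighbouring interval of length \<open>\<epsilon>\<close> with
  \<open>\<mu> = 1/2\<close>. All estimates carry the bounded input along explicitly, so neither existence of
  solutions nor superposition is needed, and they give
  \<open>V(t + 2 T) \<le> \<gamma> V(t) + c (sup \<bar>u\<bar>)\<^sup>2\<close> with \<open>\<gamma> < 1\<close>.
\<close>

section \<open>Absolutely continuous functions\<close>

text \<open>Each state bound comes from a multiplier: a linear functional of the state with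
  time-dependent weights, chosen so that its derivative along solutions contains at most
  \<open>x\<^sub>4\<close> and the input. Integrating it works along any given trajectory, tolerates
  an equation that holds only almost everywhere, and gives constants that depend on \<epsilon>, T
  and the circuit but not on where the switching instants fall. The window has length 2 T because
  the last piece of information comes from the first \<epsilon> of the second period, and a whole
  number of periods keeps consecutive windows on the switching grid, so that the estimate can be
  iterated. With an input the energy may grow. Bounding the energy at the switching instant by the
  dissipated amount then yields a contraction only if the growth factor 1 + \<eta> is close enough
  to 1; Young's inequality buys this at the price of a larger coefficient of the squared input
  bound.\<close>

text \<open>Straight from the definition of the gauge integral, so integrability of
  \<open>f'\<close> is part of the conclusion. Off \<open>N\<close> the derivative controls each
  piece of a fine division; on \<open>N\<close> absolute continuity does, once the gauge confines
  those pieces to a set of small measure.\<close>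

theorem fundamental_theorem_of_calculus_abs_cont:
  fixes f :: "real \<Rightarrow> 'a::banach"
  assumes "a \<le> b" and ac: "abs_cont_on_interval a b f" and N: "negligible N"
    and vecd: "\<And>t. t \<in> {a..b} - N \<Longrightarrow> (f has_vector_derivative f' t) (at t within {a..b})"
  shows "(f' has_integral (f b - f a)) {a..b}"
proof (cases "a = b")
  case True
  then show ?thesis using has_integral_refl(2)[of f' a] by simp
next
  case False
  with \<open>a \<le> b\<close> have "a < b" by simp
  \<comment> \<open>Changing \<open>f'\<close> to 0 on \<open>N\<close> leaves the integral alone
    and removes the Riemann terms with tag in \<open>N\<close>; only the increments of
    \<open>f\<close> survive there, and these are what absolute continuity bounds.\<close>
  define g where "g t = (if t \<in> N then 0 else f' t)" for t
  have "(g has_integral (f b - f a)) {a..b}"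
    unfolding has_integral_factor_content_real
  proof safe
    fix e :: real
    assume "e > 0"
    then have e2: "e/2 > 0" by simp
    have "\<forall>x. \<exists>d>0. x \<in> {a..b} - N \<longrightarrow>
         (\<forall>y\<in>{a..b}. norm (y-x) < d \<longrightarrow> norm (f y - f x - (y-x) *\<^sub>R f' x) \<le> e/2 * norm (y-x))"
    proof
      fix x
      show "\<exists>d>0. x \<in> {a..b} - N \<longrightarrow>
         (\<forall>y\<in>{a..b}. norm (y-x) < d \<longrightarrow> norm (f y - f x - (y-x) *\<^sub>R f' x) \<le> e/2 * norm (y-x))"
      proof (cases "x \<in> {a..b} - N")
        case True
        then show ?thesis
          using vecd[OF True, unfolded has_vector_derivative_def has_derivative_within_alt] e2 by blast
      qed (auto intro: exI[of _ 1])
    qed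
    then obtain d where d: "\<And>x. 0 < d x"
                 "\<And>x y. \<lbrakk>x \<in> {a..b} - N; y \<in> {a..b}; norm (y-x) < d x\<rbrakk>
                        \<Longrightarrow> norm (f y - f x - (y-x) *\<^sub>R f' x) \<le> e/2 * norm (y-x)"
      by metis
    have "e/2 * (b - a) > 0" using e2 \<open>a < b\<close> by simp
    with ac have "\<exists>\<delta>>0. \<forall>D. finite D \<longrightarrow> (\<forall>(c, d)\<in>D. a \<le> c \<and> c < d \<and> d \<le> b) \<longrightarrow>
        disjoint_family_on (\<lambda>(c, d). {c<..<d}) D \<longrightarrow> (\<Sum>(c, d)\<in>D. d - c) < \<delta> \<longrightarrow>
        (\<Sum>(c, d)\<in>D. norm (f d - f c)) < e/2 * (b - a)"
      unfolding abs_cont_on_interval_def by (elim allE impE)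
    then obtain \<delta> where "\<delta> > 0" and \<delta>: "\<And>D. \<lbrakk>finite D; \<forall>(c, d)\<in>D. a \<le> c \<and> c < d \<and> d \<le> b;
        disjoint_family_on (\<lambda>(c, d). {c<..<d}) D; (\<Sum>(c, d)\<in>D. d - c) < \<delta>\<rbrakk> \<Longrightarrow>
        (\<Sum>(c, d)\<in>D. norm (f d - f c)) < e/2 * (b - a)"
      by auto
    \<comment> \<open>Outer regularity bounds only \<open>U - N\<close>; as \<open>N\<close> is
      null, \<open>U\<close> itself has measure below \<delta>.\<close>
    have "N \<in> sets lebesgue" using N by (simp add: negligible_imp_sets)
    then obtain U where "open U" "N \<subseteq> U" "U - N \<in> lmeasurable" and eU: "emeasure lebesgue (U - N) < ennreal \<delta>"
      using sets_lebesgue_outer_open[OF _ \<open>\<delta> > 0\<close>] by metis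
    have Umeas: "U \<in> lmeasurable"
    proof -
      have "N \<union> (U - N) \<in> lmeasurable"
        by (rule fmeasurable.Un[OF negligible_imp_measurable[OF N] \<open>U - N \<in> lmeasurable\<close>])
      then show ?thesis using Diff_partition[OF \<open>N \<subseteq> U\<close>] by simp
    qed
    have "emeasure lebesgue U = emeasure lebesgue (U - N)"
      using N Umeas by (subst emeasure_Diff_null_set) (auto simp: negligible_iff_null_sets)
    with eU have mU: "measure lebesgue U < \<delta>"
      using emeasure_eq_measure2[OF Umeas] ennreal_less_iff[OF measure_nonneg] by metis
    \<comment> \<open>Intervals tagged in \<open>N\<close> are confined to \<open>U\<close>, so their total length is below \<open>\<delta>\<close> and absolute
      continuity bounds their increments.\<close>
    define G where "G x = (if x \<in> N then U else ball x (d x))" for x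
    show "\<exists>\<gamma>. gauge \<gamma> \<and> (\<forall>p. p tagged_division_of {a..b} \<and> \<gamma> fine p \<longrightarrow>
      norm ((\<Sum>(x, k)\<in>p. measure lborel k *\<^sub>R g x) - (f b - f a)) \<le> e * measure lborel {a..b})"
    proof (rule exI, safe)
      show "gauge G"
        unfolding gauge_def G_def using \<open>open U\<close> \<open>N \<subseteq> U\<close> d(1) by auto
    next
      fix p
      assume ptag: "p tagged_division_of {a..b}" and finep: "G fine p"
      have finp: "finite p" using ptag by blast
      \<comment> \<open>Degenerate pieces are left out: they contribute 0, the definition of
        absolute continuity demands \<open>c < d\<close>, and several tagged pieces could share one
        degenerate interval.\<close>
      define Q where "Q = {z \<in> p. fst z \<in> N \<and> Inf (snd z) < Sup (snd z)}"
      have pK: "\<exists>u v. K = {u..v} \<and> u \<le> v \<and> a \<le> u \<and> v \<le> b \<and> x \<in> {u..v} \<and> Inf K = u \<and> Sup K = v"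
        if "(x, K) \<in> p" for x K
      proof -
        have "x \<in> K" "K \<subseteq> {a..b}" using ptag that by blast+
        moreover have "\<exists>u v. K = cbox u v" by (rule tagged_division_ofD(4)[OF ptag that])
        then obtain u v where "K = cbox u v" by blast
        ultimately show ?thesis by (intro exI[of _ u] exI[of _ v]) auto
      qed
      have ba: "b - a = (\<Sum>(x,K)\<in>p. Sup K - Inf K)" "f b - f a = (\<Sum>(x,K)\<in>p. f(Sup K) - f(Inf K))"
        using additive_tagged_division_1[where f= "\<lambda>x. x"] additive_tagged_division_1[where f= f]
            \<open>a \<le> b\<close> ptag by auto
      define h where "h z = (case z of (x,K) \<Rightarrow> measure lborel K *\<^sub>R g x - (f (Sup K) - f (Inf K)))" for z
      have hp: "norm (h z) \<le> (e/2) * (case z of (x,K) \<Rightarrow> Sup K - Inf K)" if "z \<in> p - Q" for z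
      proof -
        obtain x K where z: "z = (x,K)" by fastforce
        with that have xK: "(x,K) \<in> p" by simp
        obtain u v where uv: "K = {u..v}" "u \<le> v" "a \<le> u" "v \<le> b" "x \<in> {u..v}" "Inf K = u" "Sup K = v"
          using pK[OF xK] by blast
        show ?thesis
        proof (cases "x \<in> N")
          case True
          then have "u = v" using that uv z by (auto simp: Q_def)
          then show ?thesis using uv by (simp add: h_def z)
        next
          case False
          have "K \<subseteq> ball x (d x)" using fineD[OF finep xK] False by (simp add: G_def)
          moreover have "u \<in> K" "v \<in> K" using uv by auto
          ultimately have "u \<in> ball x (d x)" "v \<in> ball x (d x)" by blast+
          then have n: "norm (u - x) < d x" "norm (v - x) < d x"
            by (simp_all add: dist_norm norm_minus_commute)
          \<comment> \<open>Straddle argument: both endpoints are compared with the tag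
            \<open>x\<close>, and since \<open>u \<le> x \<le> v\<close> the two errors add up to a
            multiple of exactly \<open>v - u\<close>.\<close>
          have "norm ((v - u) *\<^sub>R f' x - (f v - f u)) = norm (f u - f x - (u - x) *\<^sub>R f' x - (f v - f x - (v - x) *\<^sub>R f' x))"
            by (auto simp: algebra_simps)
          also have "\<dots> \<le> norm (f u - f x - (u - x) *\<^sub>R f' x) + norm (f v - f x - (v - x) *\<^sub>R f' x)"
            by (rule norm_triangle_ineq4)
          also have "\<dots> \<le> e/2 * norm (u - x) + e/2 * norm (v - x)"
            using uv False n by (intro add_mono d(2)) auto
          also have "\<dots> = e/2 * (v - u)"
            using uv by (simp add: field_simps)
          finally show ?thesis using uv False by (simp add: h_def z g_def)
        qed
      qed
      have hQ: "norm (h z) = (case z of (x,K) \<Rightarrow> norm (f (Sup K) - f (Inf K)))" if "z \<in> Q" for z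
        using that by (cases z) (auto simp: Q_def h_def g_def norm_minus_commute)
      \<comment> \<open>Absolute continuity sums over a set of endpoint pairs, so dropping the tags
        must not merge terms. Two tagged pieces over the same nondegenerate interval would have
        overlapping interiors.\<close>
      have inj: "inj_on (\<lambda>(x,K). (Inf K, Sup K)) Q"
      proof (rule inj_onI, clarify)
        fix x K x' K'
        assume Q: "(x,K) \<in> Q" "(x',K') \<in> Q" and eq: "Inf K = Inf K'" "Sup K = Sup K'"
        then have p: "(x,K) \<in> p" "(x',K') \<in> p" by (auto simp: Q_def)
        have KK: "K = K'" using pK[OF p(1)] pK[OF p(2)] eq by auto
        show "x = x' \<and> K = K'"
        proof (rule ccontr)
          assume "\<not> ?thesis"
          then have "interior K \<inter> interior K' = {}" using ptag p by blast
          moreover have "interior K = {Inf K<..<Sup K}" "Inf K < Sup K"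
            using Q(1) pK[OF p(1)] by (metis interior_atLeastAtMost_real, simp add: Q_def)
          ultimately show False using KK by (metis Int_absorb greaterThanLessThan_empty_iff not_less)
        qed
      qed
      define D where "D = (\<lambda>(x,K). (Inf K, Sup K)) ` Q"
      have finQ: "finite Q" using finp by (simp add: Q_def)
      have finD: "finite D" by (simp add: D_def finQ)
      have D1': "a \<le> c \<and> c < d \<and> d \<le> b" if "(c,d) \<in> D" for c d
      proof -
        from that obtain x K where "(x,K) \<in> Q" and e: "c = Inf K" "d = Sup K"
          by (auto simp: D_def)
        then have "(x,K) \<in> p" "c < d" by (auto simp: Q_def)
        with pK[OF this(1)] e show ?thesis by auto
      qed
      then have D1: "\<forall>(c, d)\<in>D. a \<le> c \<and> c < d \<and> d \<le> b" by auto
      have D2: "disjoint_family_on (\<lambda>(c, d). {c<..<d}) D"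
        unfolding disjoint_family_on_def
      proof (intro ballI impI)
        fix i j
        assume ij: "i \<in> D" "j \<in> D" "i \<noteq> j"
        obtain c c' d d' where [simp]: "i = (c,c')" "j = (d,d')" by (metis surj_pair)
        have cd: "(c,c') \<in> D" "(d,d') \<in> D" and ne: "\<not> (c = d \<and> c' = d')"
          using ij by auto
        from cd obtain x K y L where Q: "(x,K) \<in> Q" "(y,L) \<in> Q" and e: "c = Inf K" "c' = Sup K" "d = Inf L" "d' = Sup L"
          by (auto simp: D_def)
        have p: "(x,K) \<in> p" "(y,L) \<in> p" using Q by (auto simp: Q_def)
        have "(x,K) \<noteq> (y,L)" using ne e by auto
        then have "interior K \<inter> interior L = {}" using ptag p by blast
        moreover have "interior K = {c<..<c'}"
          using pK[OF p(1)] unfolding e by (metis interior_atLeastAtMost_real)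
        moreover have "interior L = {d<..<d'}"
          using pK[OF p(2)] unfolding e by (metis interior_atLeastAtMost_real)
        ultimately show "(\<lambda>(c, d). {c<..<d}) i \<inter> (\<lambda>(c, d). {c<..<d}) j = {}" by simp
      qed
      define I where "I = (\<lambda>(c, d). {c<..<d::real})"
      \<comment> \<open>The total length is the measure of a disjoint union inside \<open>U\<close>,
        hence below \<delta>.\<close>
      have "(\<Sum>(c, d)\<in>D. d - c) = (\<Sum>z\<in>D. measure lebesgue (I z))"
      proof (rule sum.cong[OF refl])
        fix z assume "z \<in> D"
        moreover obtain c d where [simp]: "z = (c,d)" by fastforce
        ultimately have "c < d" using D1'[of c d] by simp
        then show "(case z of (c, d) \<Rightarrow> d - c) = measure lebesgue (I z)"
          by (simp add: I_def)
      qed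
      also have "\<dots> = measure lebesgue (\<Union>z\<in>D. I z)"
      proof (rule measure_finite_Union[of D I lebesgue, symmetric])
        show "disjoint_family_on I D" using D2 by (simp only: I_def)
        show "I ` D \<subseteq> sets lebesgue" by (rule image_subsetI) (simp add: I_def split: prod.split)
        show "emeasure lebesgue (I z) \<noteq> \<infinity>" if "z \<in> D" for z
        proof -
          obtain c d where z: "z = (c,d)" by fastforce
          have "I z \<in> lmeasurable" by (simp add: I_def z)
          from fmeasurableD2[OF this] show ?thesis by (simp only: infinity_ennreal_def not_False_eq_True)
        qed
      qed (rule finD)
      also have "\<dots> \<le> measure lebesgue U"
      proof (rule measure_mono_fmeasurable)
        show "(\<Union>z\<in>D. I z) \<subseteq> U"
        proof clarify
          fix s c d
          assume "(c,d) \<in> D" and "s \<in> I (c,d)"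
          then have s: "s \<in> {c<..<d}" by (simp add: I_def)
          from \<open>(c,d) \<in> D\<close> obtain x K where Q: "(x,K) \<in> Q" and e: "c = Inf K" "d = Sup K"
            by (auto simp: D_def)
          then have p: "(x,K) \<in> p" "x \<in> N" by (auto simp: Q_def)
          have "K \<subseteq> U" using fineD[OF finep p(1)] p(2) unfolding G_def by (simp only: if_True)
          moreover obtain u v where "K = {u..v}" "Inf K = u" "Sup K = v" using pK[OF p(1)] by blast
          then have "s \<in> K" using s unfolding e by (metis atLeastAtMost_iff greaterThanLessThan_iff less_imp_le)
          ultimately show "s \<in> U" by blast
        qed
        show "U \<in> lmeasurable" by (rule Umeas)
        have "open (\<Union>z\<in>D. I z)" by (rule open_UN) (auto simp: I_def)
        then show "(\<Union>z\<in>D. I z) \<in> sets lebesgue" by (rule lebesgue_openin[of UNIV, simplified])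
      qed
      finally have D3: "(\<Sum>(c, d)\<in>D. d - c) < \<delta>" using mU by (rule le_less_trans)
      have "(\<Sum>z\<in>Q. norm (h z)) = (\<Sum>(x,K)\<in>Q. norm (f (Sup K) - f (Inf K)))"
        using hQ by (intro sum.cong) auto
      also have "\<dots> = (\<Sum>(c, d)\<in>D. norm (f d - f c))"
        unfolding D_def by (subst sum.reindex[OF inj]) (auto simp: case_prod_unfold)
      also have "\<dots> < e/2 * (b - a)" by (rule \<delta>[OF finD D1 D2 D3])
      finally have A: "(\<Sum>z\<in>Q. norm (h z)) \<le> e/2 * (b - a)" by simp
      have "(\<Sum>z\<in>p-Q. norm (h z)) \<le> (\<Sum>z\<in>p-Q. (e/2) * (case z of (x,K) \<Rightarrow> Sup K - Inf K))"
        by (rule sum_mono) (rule hp)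
      also have "\<dots> \<le> (\<Sum>z\<in>p. (e/2) * (case z of (x,K) \<Rightarrow> Sup K - Inf K))"
      proof (rule sum_mono2)
        fix z assume z: "z \<in> p - (p - Q)"
        obtain x K where [simp]: "z = (x,K)" by fastforce
        have "(x,K) \<in> p" using z by simp
        from pK[OF this] show "0 \<le> (e/2) * (case z of (x,K) \<Rightarrow> Sup K - Inf K)"
          using e2 by (auto intro!: mult_nonneg_nonneg)
      qed (use finp in auto)
      also have "\<dots> = e/2 * (b - a)"
        by (simp only: ba sum_distrib_left[symmetric])
      finally have B: "(\<Sum>z\<in>p-Q. norm (h z)) \<le> e/2 * (b - a)" .
      have "(\<Sum>(x, k)\<in>p. measure lborel k *\<^sub>R g x) - (f b - f a) = (\<Sum>z\<in>p. h z)"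
        unfolding ba(2) sum_subtractf[symmetric] h_def by (intro sum.cong) auto
      also have "norm \<dots> \<le> (\<Sum>z\<in>p. norm (h z))" by (rule norm_sum)
      also have "\<dots> = (\<Sum>z\<in>p-Q. norm (h z)) + (\<Sum>z\<in>Q. norm (h z))"
        by (rule sum.subset_diff) (use finp in \<open>auto simp: Q_def\<close>)
      also have "\<dots> \<le> e * (b - a)" using A B by (simp add: algebra_simps)
      finally show "norm ((\<Sum>(x, k)\<in>p. measure lborel k *\<^sub>R g x) - (f b - f a)) \<le> e * measure lborel {a..b}"
        using \<open>a < b\<close> by simp
    qed
  qed
  then show ?thesis
    by (rule has_integral_spike[OF N, rotated]) (simp add: g_def)
qed

section \<open>Closure properties of absolute continuity\<close>

text \<open>Reduces closure properties (components, sums, products, Lipschitz functions) to a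
  pointwise bound on increments, so that families of intervals are handled once. The functions may
  have different codomains, which covers passing from a vector to its components.\<close>

lemma abs_cont_on_interval_comparison:
  assumes f: "abs_cont_on_interval a b f" and g: "abs_cont_on_interval a b g"
    and h: "\<And>c d. \<lbrakk>a \<le> c; c < d; d \<le> b\<rbrakk> \<Longrightarrow> norm (h d - h c) \<le> M * (norm (f d - f c) + norm (g d - g c))"
    and "M > 0"
  shows "abs_cont_on_interval a b h"
  unfolding abs_cont_on_interval_def
proof (intro allI impI)
  fix e :: real
  assume "e > 0"
  then have e: "e / (2*M) > 0" using \<open>M > 0\<close> by simp
  from f[unfolded abs_cont_on_interval_def, rule_format, OF e]
  obtain d1 where "d1 > 0" and d1: "\<And>D. finite D \<Longrightarrow> (\<forall>(c, d)\<in>D. a \<le> c \<and> c < d \<and> d \<le> b) \<Longrightarrow>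
        disjoint_family_on (\<lambda>(c, d). {c<..<d}) D \<Longrightarrow> (\<Sum>(c, d)\<in>D. d - c) < d1 \<Longrightarrow>
        (\<Sum>(c, d)\<in>D. norm (f d - f c)) < e / (2*M)"
    by auto
  from g[unfolded abs_cont_on_interval_def, rule_format, OF e]
  obtain d2 where "d2 > 0" and d2: "\<And>D. finite D \<Longrightarrow> (\<forall>(c, d)\<in>D. a \<le> c \<and> c < d \<and> d \<le> b) \<Longrightarrow>
        disjoint_family_on (\<lambda>(c, d). {c<..<d}) D \<Longrightarrow> (\<Sum>(c, d)\<in>D. d - c) < d2 \<Longrightarrow>
        (\<Sum>(c, d)\<in>D. norm (g d - g c)) < e / (2*M)"
    by auto
  show "\<exists>\<delta>>0. \<forall>D. finite D \<longrightarrow> (\<forall>(c, d)\<in>D. a \<le> c \<and> c < d \<and> d \<le> b) \<longrightarrow>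
        disjoint_family_on (\<lambda>(c, d). {c<..<d}) D \<longrightarrow> (\<Sum>(c, d)\<in>D. d - c) < \<delta> \<longrightarrow>
        (\<Sum>(c, d)\<in>D. norm (h d - h c)) < e"
  proof (intro exI[of _ "min d1 d2"] conjI allI impI)
    show "min d1 d2 > 0" using \<open>d1 > 0\<close> \<open>d2 > 0\<close> by simp
    fix D
    assume D: "finite D" "\<forall>(c, d)\<in>D. a \<le> c \<and> c < d \<and> d \<le> b"
        "disjoint_family_on (\<lambda>(c, d). {c<..<d}) D" "(\<Sum>(c, d)\<in>D. d - c) < min d1 d2"
    have "(\<Sum>(c, d)\<in>D. norm (h d - h c)) \<le> (\<Sum>z\<in>D. M * (case z of (c,d) \<Rightarrow> norm (f d - f c)) + M * (case z of (c,d) \<Rightarrow> norm (g d - g c)))"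
    proof (rule sum_mono)
      fix z assume "z \<in> D"
      moreover obtain c d where [simp]: "z = (c,d)" by (cases z)
      ultimately have "a \<le> c" "c < d" "d \<le> b" using D(2) by auto
      from h[OF this] show "(case z of (c,d) \<Rightarrow> norm (h d - h c)) \<le> M * (case z of (c,d) \<Rightarrow> norm (f d - f c)) + M * (case z of (c,d) \<Rightarrow> norm (g d - g c))"
        by (simp add: distrib_left)
    qed
    also have "\<dots> = M * (\<Sum>(c, d)\<in>D. norm (f d - f c)) + M * (\<Sum>(c, d)\<in>D. norm (g d - g c))"
      by (simp only: sum.distrib sum_distrib_left)
    also have "\<dots> < M * (e / (2*M)) + M * (e / (2*M))"
    proof (intro add_strict_mono mult_strict_left_mono)
      show "(\<Sum>(c, d)\<in>D. norm (f d - f c)) < e / (2*M)"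
        by (rule d1) (use D in simp_all)
      show "(\<Sum>(c, d)\<in>D. norm (g d - g c)) < e / (2*M)"
        by (rule d2) (use D in simp_all)
    qed (use \<open>M > 0\<close> in auto)
    also have "\<dots> = e" using \<open>M > 0\<close> by (simp add: field_simps)
    finally show "(\<Sum>(c, d)\<in>D. norm (h d - h c)) < e" .
  qed
qed

lemma abs_cont_on_interval_subinterval:
  assumes "abs_cont_on_interval a b f" "a \<le> c" "d \<le> b"
  shows "abs_cont_on_interval c d f"
  unfolding abs_cont_on_interval_def
proof (intro allI impI)
  fix e :: real
  assume e: "e > 0"
  from assms(1)[unfolded abs_cont_on_interval_def, rule_format, OF e]
  obtain d1 where "d1 > 0" and d1: "\<And>D. finite D \<Longrightarrow> (\<forall>(c, d)\<in>D. a \<le> c \<and> c < d \<and> d \<le> b) \<Longrightarrow>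
        disjoint_family_on (\<lambda>(c, d). {c<..<d}) D \<Longrightarrow> (\<Sum>(c, d)\<in>D. d - c) < d1 \<Longrightarrow>
        (\<Sum>(c, d)\<in>D. norm (f d - f c)) < e"
    by auto
  show "\<exists>\<delta>>0. \<forall>D. finite D \<longrightarrow> (\<forall>(c', d')\<in>D. c \<le> c' \<and> c' < d' \<and> d' \<le> d) \<longrightarrow>
        disjoint_family_on (\<lambda>(c, d). {c<..<d}) D \<longrightarrow> (\<Sum>(c, d)\<in>D. d - c) < \<delta> \<longrightarrow>
        (\<Sum>(c, d)\<in>D. norm (f d - f c)) < e"
  proof (intro exI[of _ d1] conjI allI impI)
    fix D
    assume D: "finite D" "\<forall>(c', d')\<in>D. c \<le> c' \<and> c' < d' \<and> d' \<le> d"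
      "disjoint_family_on (\<lambda>(c, d). {c<..<d}) D" "(\<Sum>(c, d)\<in>D. d - c) < d1"
    have "\<forall>(c, d)\<in>D. a \<le> c \<and> c < d \<and> d \<le> b"
      using D(2) assms(2,3) by (auto split: prod.splits intro: order_trans)
    from d1[OF D(1) this D(3,4)] show "(\<Sum>(c, d)\<in>D. norm (f d - f c)) < e" .
  qed (rule \<open>d1 > 0\<close>)
qed

lemma abs_cont_on_interval_id: "abs_cont_on_interval a b (\<lambda>t. t)"
  unfolding abs_cont_on_interval_def
proof (intro allI impI)
  fix e :: real
  assume e: "e > 0"
  show "\<exists>\<delta>>0. \<forall>D. finite D \<longrightarrow> (\<forall>(c, d)\<in>D. a \<le> c \<and> c < d \<and> d \<le> b) \<longrightarrow>
        disjoint_family_on (\<lambda>(c, d). {c<..<d}) D \<longrightarrow> (\<Sum>(c, d)\<in>D. d - c) < \<delta> \<longrightarrow>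
        (\<Sum>(c, d)\<in>D. norm (d - c)) < e"
  proof (intro exI[of _ e] conjI allI impI)
    fix D :: "(real \<times> real) set"
    assume D: "\<forall>(c, d)\<in>D. a \<le> c \<and> c < d \<and> d \<le> b" "(\<Sum>(c, d)\<in>D. d - c) < e"
    have "(\<Sum>(c, d)\<in>D. norm (d - c)) = (\<Sum>(c, d)\<in>D. d - c)"
      using D(1) by (intro sum.cong) auto
    then show "(\<Sum>(c, d)\<in>D. norm (d - c)) < e" using D(2) by simp
  qed (rule e)
qed

lemma abs_cont_on_interval_lipschitz:
  fixes f :: "real \<Rightarrow> 'a::real_normed_vector"
  assumes "\<And>c d. \<lbrakk>a \<le> c; c < d; d \<le> b\<rbrakk> \<Longrightarrow> norm (f d - f c) \<le> M * (d - c)"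
  shows "abs_cont_on_interval a b f"
\<comment> \<open>The identity serves as both comparison functions; \<open>\<bar>M\<bar> + 1\<close>
  is positive whatever the sign of \<open>M\<close>.\<close>
proof (rule abs_cont_on_interval_comparison[OF abs_cont_on_interval_id abs_cont_on_interval_id, where M = "\<bar>M\<bar> + 1"])
  fix c d :: real
  assume cd: "a \<le> c" "c < d" "d \<le> b"
  have "norm (f d - f c) \<le> M * (d - c)" by (rule assms[OF cd])
  also have "\<dots> \<le> (\<bar>M\<bar> + 1) * (norm (d - c) + norm (d - c))"
    using cd by (intro mult_mono) auto
  finally show "norm (f d - f c) \<le> (\<bar>M\<bar> + 1) * (norm (d - c) + norm (d - c))" .
qed auto

lemma abs_cont_on_interval_imp_continuous_on:
  assumes "abs_cont_on_interval a b f"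
  shows "continuous_on {a..b} f"
  unfolding continuous_on_iff
proof (intro ballI allI impI)
  fix x e :: real
  assume x: "x \<in> {a..b}" and e: "e > 0"
  from assms[unfolded abs_cont_on_interval_def, rule_format, OF e]
  obtain \<delta> where "\<delta> > 0" and \<delta>: "\<And>D. finite D \<Longrightarrow> (\<forall>(c, d)\<in>D. a \<le> c \<and> c < d \<and> d \<le> b) \<Longrightarrow>
        disjoint_family_on (\<lambda>(c, d). {c<..<d}) D \<Longrightarrow> (\<Sum>(c, d)\<in>D. d - c) < \<delta> \<Longrightarrow>
        (\<Sum>(c, d)\<in>D. norm (f d - f c)) < e"
    by auto
  have *: "norm (f d - f c) < e" if "a \<le> c" "c < d" "d \<le> b" "d - c < \<delta>" for c d
    using \<delta>[of "{(c,d)}"] that by (simp add: disjoint_family_on_def)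
  show "\<exists>d>0. \<forall>x'\<in>{a..b}. dist x' x < d \<longrightarrow> dist (f x') (f x) < e"
  proof (intro exI[of _ \<delta>] conjI ballI impI)
    fix x'
    assume x': "x' \<in> {a..b}" "dist x' x < \<delta>"
    consider "x' = x" | "x' < x" | "x < x'" by linarith
    then show "dist (f x') (f x) < e"
    proof cases
      case 1 then show ?thesis using e by simp
    next
      case 2
      then have "norm (f x - f x') < e" using x x' by (intro *) (auto simp: dist_real_def)
      then show ?thesis by (simp add: dist_norm norm_minus_commute)
    next
      case 3
      then have "norm (f x' - f x) < e" using x x' by (intro *) (auto simp: dist_real_def)
      then show ?thesis by (simp add: dist_norm)
    qed
  qed (rule \<open>\<delta> > 0\<close>)
qed

lemma continuous_on_Icc_bounded:
  fixes f :: "real \<Rightarrow> real"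
  assumes "continuous_on {a..b} f"
  obtains M where "M > 0" "\<And>t. a \<le> t \<Longrightarrow> t \<le> b \<Longrightarrow> \<bar>f t\<bar> \<le> M"
proof -
  have "bounded (f ` {a..b})"
    using assms by (intro compact_imp_bounded compact_continuous_image) auto
  then obtain M where "M > 0" "\<forall>y\<in>f ` {a..b}. norm y \<le> M"
    unfolding bounded_pos by blast
  then show ?thesis using that by simp
qed

lemma abs_cont_on_interval_mult:
  fixes f g :: "real \<Rightarrow> real"
  assumes f: "abs_cont_on_interval a b f" and g: "abs_cont_on_interval a b g"
  shows "abs_cont_on_interval a b (\<lambda>t. f t * g t)"
proof -
  obtain F where F: "\<And>t. a \<le> t \<Longrightarrow> t \<le> b \<Longrightarrow> \<bar>f t\<bar> \<le> F"
    using continuous_on_Icc_bounded[OF abs_cont_on_interval_imp_continuous_on[OF f]] by blast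
  obtain G where G: "\<And>t. a \<le> t \<Longrightarrow> t \<le> b \<Longrightarrow> \<bar>g t\<bar> \<le> G"
    using continuous_on_Icc_bounded[OF abs_cont_on_interval_imp_continuous_on[OF g]] by blast
  define M where "M = \<bar>F\<bar> + \<bar>G\<bar> + 1"
  have M: "\<bar>f t\<bar> \<le> M" "\<bar>g t\<bar> \<le> M" if "t \<in> {a..b}" for t
    using F[of t] G[of t] that by (auto simp: M_def)
  show ?thesis
  proof (rule abs_cont_on_interval_comparison[OF f g, where M = M])
    fix c d
    assume cd: "a \<le> c" "c < d" "d \<le> b"
    have "f d * g d - f c * g c = (f d - f c) * g d + f c * (g d - g c)"
      by (simp add: algebra_simps)
    also have "\<bar>\<dots>\<bar> \<le> \<bar>f d - f c\<bar> * \<bar>g d\<bar> + \<bar>f c\<bar> * \<bar>g d - g c\<bar>"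
      by (metis abs_mult abs_triangle_ineq)
    also have "\<dots> \<le> \<bar>f d - f c\<bar> * M + M * \<bar>g d - g c\<bar>"
      using M cd by (intro add_mono mult_left_mono mult_right_mono) auto
    finally show "norm (f d * g d - f c * g c) \<le> M * (norm (f d - f c) + norm (g d - g c))"
      by (simp add: algebra_simps)
  qed (simp add: M_def)
qed

section \<open>Calculus of almost-everywhere derivatives of absolutely continuous functions\<close>

text \<open>The derivative is carried as an explicit formula so that sum and product rules compute
  the derivative of a multiplier expression. The null set stays existential and is enlarged by each
  rule as required.\<close>

definition ac_deriv :: "(real \<Rightarrow> real) \<Rightarrow> (real \<Rightarrow> real) \<Rightarrow> real \<Rightarrow> real \<Rightarrow> bool" where
  "ac_deriv f f' a b \<longleftrightarrow> abs_cont_on_interval a b f \<and>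
     (\<exists>N. negligible N \<and> (\<forall>t\<in>{a..b} - N. (f has_real_derivative f' t) (at t within {a..b})))"

lemma ac_deriv_continuous_on: "ac_deriv f f' a b \<Longrightarrow> continuous_on {a..b} f"
  by (simp add: ac_deriv_def abs_cont_on_interval_imp_continuous_on)

text \<open>The agreement is asked on a half-open interval because the value of \<open>\<mu>\<close>
  in a mode is known only up to, and not at, the switching instant; the point \<open>b\<close> joins
  the null set.\<close>

lemma ac_deriv_cong:
  assumes "ac_deriv f f' a b" "\<And>t. a \<le> t \<Longrightarrow> t < b \<Longrightarrow> f' t = g' t"
  shows "ac_deriv f g' a b"
proof -
  from assms(1) obtain N where N: "abs_cont_on_interval a b f" "negligible N"
    "\<And>t. t \<in> {a..b} - N \<Longrightarrow> (f has_real_derivative f' t) (at t within {a..b})"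
    unfolding ac_deriv_def by blast
  have "\<forall>t\<in>{a..b} - insert b N. (f has_real_derivative g' t) (at t within {a..b})"
  proof
    fix t assume t: "t \<in> {a..b} - insert b N"
    then show "(f has_real_derivative g' t) (at t within {a..b})"
      using N(3)[of t] assms(2)[of t] by auto
  qed
  then show ?thesis
    unfolding ac_deriv_def using N(1,2) by (metis negligible_insert)
qed

lemma ac_deriv_subinterval:
  assumes "ac_deriv f f' a b" "a \<le> c" "d \<le> b"
  shows "ac_deriv f f' c d"
proof -
  from assms(1) obtain N where N: "abs_cont_on_interval a b f" "negligible N"
    "\<And>t. t \<in> {a..b} - N \<Longrightarrow> (f has_real_derivative f' t) (at t within {a..b})"
    unfolding ac_deriv_def by blast
  have "\<forall>t\<in>{c..d} - N. (f has_real_derivative f' t) (at t within {c..d})"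
    using N(3) assms(2,3) by (auto intro!: has_field_derivative_subset[where s = "{a..b}" and t = "{c..d}"])
  then show ?thesis
    unfolding ac_deriv_def using N(1,2) assms(2,3) abs_cont_on_interval_subinterval by blast
qed

lemma ac_deriv_mult:
  assumes "ac_deriv f f' a b" "ac_deriv g g' a b"
  shows "ac_deriv (\<lambda>t. f t * g t) (\<lambda>t. f' t * g t + f t * g' t) a b"
proof -
  from assms obtain N M where *: "abs_cont_on_interval a b f" "negligible N" "abs_cont_on_interval a b g" "negligible M"
    "\<And>t. t \<in> {a..b} - N \<Longrightarrow> (f has_real_derivative f' t) (at t within {a..b})"
    "\<And>t. t \<in> {a..b} - M \<Longrightarrow> (g has_real_derivative g' t) (at t within {a..b})"
    unfolding ac_deriv_def by metis
  have "((\<lambda>t. f t * g t) has_real_derivative f' t * g t + f t * g' t) (at t within {a..b})"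
    if "t \<in> {a..b} - (N \<union> M)" for t
    using *(5)[of t] *(6)[of t] that by (auto intro!: derivative_eq_intros)
  then show ?thesis
    unfolding ac_deriv_def using *(1-4) abs_cont_on_interval_mult by (metis negligible_Un)
qed

lemma ac_deriv_add:
  assumes "ac_deriv f f' a b" "ac_deriv g g' a b"
  shows "ac_deriv (\<lambda>t. f t + g t) (\<lambda>t. f' t + g' t) a b"
proof -
  from assms obtain N M where *: "abs_cont_on_interval a b f" "negligible N" "abs_cont_on_interval a b g" "negligible M"
    "\<And>t. t \<in> {a..b} - N \<Longrightarrow> (f has_real_derivative f' t) (at t within {a..b})"
    "\<And>t. t \<in> {a..b} - M \<Longrightarrow> (g has_real_derivative g' t) (at t within {a..b})"
    unfolding ac_deriv_def by metis
  have "((\<lambda>t. f t + g t) has_real_derivative f' t + g' t) (at t within {a..b})"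
    if "t \<in> {a..b} - (N \<union> M)" for t
    using *(5)[of t] *(6)[of t] that by (auto intro!: derivative_eq_intros)
  moreover have "abs_cont_on_interval a b (\<lambda>t. f t + g t)"
    by (rule abs_cont_on_interval_comparison[OF *(1,3), where M = 1]) auto
  ultimately show ?thesis
    unfolding ac_deriv_def using *(2,4) by (metis negligible_Un)
qed

text \<open>Admits the explicit weights (polynomials, sine, cosine) into the calculus: a bounded
  derivative makes them Lipschitz by the mean value theorem.\<close>

lemma ac_deriv_C1:
  assumes d: "\<And>t. (f has_real_derivative f' t) (at t)" and c: "continuous_on {a..b} f'"
  shows "ac_deriv f f' a b"
proof -
  obtain M where M: "\<And>t. a \<le> t \<Longrightarrow> t \<le> b \<Longrightarrow> \<bar>f' t\<bar> \<le> M"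
    using continuous_on_Icc_bounded[OF c] by blast
  have "abs_cont_on_interval a b f"
  proof (rule abs_cont_on_interval_lipschitz[where M = M])
    fix c e assume ce: "a \<le> c" "c < e" "e \<le> b"
    then obtain z where z: "c < z" "z < e" "f e - f c = (e - c) * f' z"
      using MVT2[of c e f f'] d by blast
    with M[of z] ce have "\<bar>f e - f c\<bar> \<le> (e - c) * M"
      by (auto simp: abs_mult intro!: mult_mono)
    then show "norm (f e - f c) \<le> M * (e - c)" by (simp add: mult.commute)
  qed
  then show ?thesis
    unfolding ac_deriv_def using d has_field_derivative_at_within negligible_empty by blast
qed

lemma ac_deriv_cmult:
  assumes "ac_deriv f f' a b"
  shows "ac_deriv (\<lambda>t. c * f t) (\<lambda>t. c * f' t) a b"
  using ac_deriv_mult[OF ac_deriv_C1[of "\<lambda>_. c" "\<lambda>_. 0"] assms] by simp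

lemma ac_deriv_has_integral:
  assumes "ac_deriv f f' a b" "a \<le> b"
  shows "(f' has_integral (f b - f a)) {a..b}"
proof -
  from assms(1) obtain N where N: "abs_cont_on_interval a b f" "negligible N"
    "\<And>t. t \<in> {a..b} - N \<Longrightarrow> (f has_real_derivative f' t) (at t within {a..b})"
    unfolding ac_deriv_def by blast
  show ?thesis
    using N by (intro fundamental_theorem_of_calculus_abs_cont[OF \<open>a \<le> b\<close>, of _ N])
      (auto simp: has_real_derivative_iff_has_vector_derivative)
qed

lemma ac_deriv_le_integral:
  assumes "ac_deriv f f' a b" "a \<le> b" "\<And>t. a \<le> t \<Longrightarrow> t < b \<Longrightarrow> f' t \<le> h t" "h integrable_on {a..b}"
  shows "f b - f a \<le> integral {a..b} h"
proof -
  \<comment> \<open>The bound on \<open>f'\<close> is missing at \<open>b\<close>, so the derivative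
    is replaced there by \<open>h\<close>; then the comparison of integrals holds at every point of
    the closed interval.\<close>
  have "ac_deriv f (\<lambda>t. if t < b then f' t else h t) a b"
    by (rule ac_deriv_cong[OF assms(1)]) simp
  from ac_deriv_has_integral[OF this \<open>a \<le> b\<close>] integrable_integral[OF assms(4)] show ?thesis
    by (rule has_integral_le) (use assms(3) in auto)
qed

lemma ac_deriv_abs_le_integral:
  assumes "ac_deriv f f' a b" "a \<le> b" "\<And>t. a \<le> t \<Longrightarrow> t < b \<Longrightarrow> \<bar>f' t\<bar> \<le> h t" "h integrable_on {a..b}"
  shows "\<bar>f b - f a\<bar> \<le> integral {a..b} h"
proof -
  have "f b - f a \<le> integral {a..b} h"
    using assms by (intro ac_deriv_le_integral[OF assms(1)]) (auto intro: order_trans[OF abs_ge_self])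
  moreover have "(-1) * f b - (-1) * f a \<le> integral {a..b} h"
    using assms by (intro ac_deriv_le_integral[OF ac_deriv_cmult[OF assms(1)]])
      (auto intro: order_trans[OF abs_ge_minus_self])
  ultimately show ?thesis by (simp add: abs_le_iff)
qed

lemma trajectory_imp_ac_deriv:
  fixes x :: "real \<Rightarrow> real ^ 'n"
  assumes "trajectory f x" "0 \<le> a" "a \<le> b"
  shows "ac_deriv (\<lambda>t. x t $ i) (\<lambda>t. f t (x t) $ i) a b"
proof -
  have ac: "abs_cont_on_interval a b x"
    using assms by (simp add: trajectory_def locally_abs_cont_def)
  have "abs_cont_on_interval a b (\<lambda>t. x t $ i)"
  proof (rule abs_cont_on_interval_comparison[OF ac ac, where M = 1])
    fix c d
    have "norm (x d $ i - x c $ i) \<le> norm (x d - x c)"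
      by (metis component_le_norm_cart real_norm_def vector_minus_component)
    also have "\<dots> \<le> 1 * (norm (x d - x c) + norm (x d - x c))" by simp
    finally show "norm (x d $ i - x c $ i) \<le> 1 * (norm (x d - x c) + norm (x d - x c))" .
  qed simp
  moreover have "AE t in lebesgue. 0 \<le> t \<longrightarrow> (x has_vector_derivative f t (x t)) (at t within {0..})"
    using assms(1) by (simp add: trajectory_def)
  then obtain N where N: "N \<in> null_sets lebesgue"
    "{t \<in> space lebesgue. \<not> (0 \<le> t \<longrightarrow> (x has_vector_derivative f t (x t)) (at t within {0..}))} \<subseteq> N"
    by (auto simp: eventually_ae_filter)
  have "((\<lambda>t. x t $ i) has_real_derivative f t (x t) $ i) (at t within {a..b})" if "t \<in> {a..b} - N" for t
  proof -
    have "(x has_vector_derivative f t (x t)) (at t within {0..})"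
    proof (rule ccontr)
      assume "\<not> ?thesis"
      with that assms(2) have "t \<in> {t \<in> space lebesgue. \<not> (0 \<le> t \<longrightarrow> (x has_vector_derivative f t (x t)) (at t within {0..}))}"
        by simp
      with N(2) that show False by blast
    qed
    then have "(x has_vector_derivative f t (x t)) (at t within {a..b})"
      by (rule has_vector_derivative_within_subset) (use assms(2) in auto)
    then have "((\<lambda>t. x t $ i) has_vector_derivative f t (x t) $ i) (at t within {a..b})"
      by (rule bounded_linear.has_vector_derivative[OF bounded_linear_vec_nth])
    then show ?thesis
      by (simp add: has_real_derivative_iff_has_vector_derivative)
  qed
  moreover have "negligible N" using N(1) by (simp add: negligible_iff_null_sets)
  ultimately show ?thesis unfolding ac_deriv_def by blast
qed

section \<open>Energy estimates for the inverter\<close>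

lemma Young_weighted:
  fixes p q k :: real
  assumes "k > 0"
  shows "2 * p * q \<le> k * p\<^sup>2 + q\<^sup>2 / k"
proof -
  have "0 \<le> (k * p - q)\<^sup>2 / k" using assms by simp
  also have "\<dots> = k * p\<^sup>2 + q\<^sup>2 / k - 2 * p * q"
    using assms by (simp add: field_simps power2_eq_square)
  finally show ?thesis by simp
qed

text \<open>Cauchy-Schwarz against the constant 1, from the nonnegative integral of
  \<open>((b - a) * \<bar>f t\<bar> - Z)\<^sup>2\<close> with \<open>Z\<close> the integral of
  \<open>\<bar>f\<bar>\<close>. It turns the integral of \<open>\<bar>x\<^sub>4\<bar>\<close>, which
  the multipliers produce, into the integral of its square, which the load dissipates.\<close>

lemma integral_abs_power2_le:
  fixes f :: "real \<Rightarrow> real"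
  assumes "continuous_on {a..b} f" "a \<le> b"
  shows "(integral {a..b} (\<lambda>t. \<bar>f t\<bar>))\<^sup>2 \<le> (b - a) * integral {a..b} (\<lambda>t. (f t)\<^sup>2)"
proof (cases "a = b")
  case False
  then have l: "b - a > 0" using assms(2) by simp
  define Z where "Z = integral {a..b} (\<lambda>t. \<bar>f t\<bar>)"
  have i: "(\<lambda>t. (f t)\<^sup>2) integrable_on {a..b}" "(\<lambda>t. \<bar>f t\<bar>) integrable_on {a..b}"
    "(\<lambda>t. ((b - a) * \<bar>f t\<bar> - Z)\<^sup>2) integrable_on {a..b}"
    by (intro integrable_continuous_interval continuous_intros assms(1))+
  have h: "((\<lambda>t. (b - a)\<^sup>2 * (f t)\<^sup>2 - (2 * (b - a) * Z) * \<bar>f t\<bar> + Z\<^sup>2) has_integral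
      (b - a)\<^sup>2 * integral {a..b} (\<lambda>t. (f t)\<^sup>2) - (2 * (b - a) * Z) * Z + (b - a) * Z\<^sup>2) {a..b}"
    using integrable_integral[OF i(1)] integrable_integral[OF i(2)] has_integral_const_real[of "Z\<^sup>2" a b] l
    by (intro has_integral_add has_integral_diff has_integral_mult_right) (auto simp: Z_def)
  have "(\<lambda>t. (b - a)\<^sup>2 * (f t)\<^sup>2 - (2 * (b - a) * Z) * \<bar>f t\<bar> + Z\<^sup>2) = (\<lambda>t. ((b - a) * \<bar>f t\<bar> - Z)\<^sup>2)"
    by (rule ext) (simp add: power2_diff power_mult_distrib)
  with h have "0 \<le> (b - a)\<^sup>2 * integral {a..b} (\<lambda>t. (f t)\<^sup>2) - (2 * (b - a) * Z) * Z + (b - a) * Z\<^sup>2"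
    by (metis (no_types, lifting) has_integral_nonneg zero_le_power2)
  also have "\<dots> = (b - a) * ((b - a) * integral {a..b} (\<lambda>t. (f t)\<^sup>2) - Z\<^sup>2)"
    by (simp add: algebra_simps power2_eq_square)
  finally show ?thesis using l by (simp add: zero_le_mult_iff Z_def)
qed simp

section \<open>Component equations and the energy balance with input\<close>

locale inverter =
  fixes L1 L2 C1 C2 R Vin :: real and \<mu> :: "real \<Rightarrow> real"
  assumes L1_pos: "L1 > 0" and L2_pos: "L2 > 0" and C1_pos: "C1 > 0" and C2_pos: "C2 > 0" and R_pos: "R > 0"
begin

lemmas param_pos = L1_pos L2_pos C1_pos C2_pos R_pos

text \<open>The rows of the switched equation multiplied out, where
  \<open>1/2 P\<^sup>-\<^sup>1\<close> is the diagonal matrix of reciprocals of the inductances and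
  capacitances. It is stated on an interval so that mode-specific estimates apply to pieces of a
  trajectory.\<close>

definition solution :: "(real \<Rightarrow> real) \<Rightarrow> (real \<Rightarrow> real ^ 4) \<Rightarrow> real \<Rightarrow> real \<Rightarrow> bool" where
  "solution u x a b \<longleftrightarrow>
     ac_deriv (\<lambda>t. x t $ 1) (\<lambda>t. ((\<mu> t - 1/2) * x t $ 3 + 2 * Vin * u t) / L1) a b \<and>
     ac_deriv (\<lambda>t. x t $ 2) (\<lambda>t. ((\<mu> t + 1/2) * x t $ 3 + x t $ 4 + 2 * Vin * u t) / L2) a b \<and>
     ac_deriv (\<lambda>t. x t $ 3) (\<lambda>t. ((1/2 - \<mu> t) * x t $ 1 - (1/2 + \<mu> t) * x t $ 2) / C1) a b \<and>
     ac_deriv (\<lambda>t. x t $ 4) (\<lambda>t. (- x t $ 2 - x t $ 4 / R) / C2) a b"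

definition energy :: "real ^ 4 \<Rightarrow> real" where
  "energy y = (L1 * (y $ 1)\<^sup>2 + L2 * (y $ 2)\<^sup>2 + C1 * (y $ 3)\<^sup>2 + C2 * (y $ 4)\<^sup>2) / 2"

lemma energy_nonneg: "energy y \<ge> 0"
  using param_pos by (simp add: energy_def)

lemma solution_subinterval:
  "solution u x a b \<Longrightarrow> a \<le> c \<Longrightarrow> d \<le> b \<Longrightarrow> solution u x c d"
  unfolding solution_def by (blast intro: ac_deriv_subinterval)

lemma solution_continuous_on:
  assumes "solution u x a b"
  shows "continuous_on {a..b} (\<lambda>t. x t $ 1)" "continuous_on {a..b} (\<lambda>t. x t $ 2)"
    "continuous_on {a..b} (\<lambda>t. x t $ 3)" "continuous_on {a..b} (\<lambda>t. x t $ 4)"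
  using assms unfolding solution_def by (blast intro: ac_deriv_continuous_on)+

text \<open>Apart from the load entry \<open>-1/R\<close>, the matrices \<open>A0q\<close> and
  \<open>E0q\<close> are skew-symmetric, so the power exchanged between the states cancels for every
  value of \<open>\<mu>\<close>; the load and the source remain.\<close>

lemma ac_deriv_energy:
  assumes "solution u x a b"
  shows "ac_deriv (\<lambda>t. energy (x t)) (\<lambda>t. 2 * Vin * u t * (x t $ 1 + x t $ 2) - (x t $ 4)\<^sup>2 / R) a b"
proof -
  note s = assms[unfolded solution_def]
  note d1 = ac_deriv_cmult[of _ _ _ _ "L1/2", OF ac_deriv_mult[OF s[THEN conjunct1] s[THEN conjunct1]]]
  note d2 = ac_deriv_cmult[of _ _ _ _ "L2/2", OF ac_deriv_mult[OF s[THEN conjunct2, THEN conjunct1] s[THEN conjunct2, THEN conjunct1]]]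
  note d3 = ac_deriv_cmult[of _ _ _ _ "C1/2", OF ac_deriv_mult[OF s[THEN conjunct2, THEN conjunct2, THEN conjunct1] s[THEN conjunct2, THEN conjunct2, THEN conjunct1]]]
  note d4 = ac_deriv_cmult[of _ _ _ _ "C2/2", OF ac_deriv_mult[OF s[THEN conjunct2, THEN conjunct2, THEN conjunct2] s[THEN conjunct2, THEN conjunct2, THEN conjunct2]]]
  have e: "(\<lambda>t. energy (x t)) = (\<lambda>t. ((L1/2 * (x t $ 1 * x t $ 1) + L2/2 * (x t $ 2 * x t $ 2)) +
     (C1/2 * (x t $ 3 * x t $ 3) + C2/2 * (x t $ 4 * x t $ 4))))"
    by (rule ext) (simp add: energy_def power2_eq_square field_simps)
  show ?thesis
    unfolding e
    by (rule ac_deriv_cong[OF ac_deriv_add[OF ac_deriv_add[OF d1 d2] ac_deriv_add[OF d3 d4]]])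
       (use param_pos in \<open>simp add: field_simps power2_eq_square\<close>)
qed

text \<open>Young's inequality with weights \<open>\<delta> * L1 / 2\<close> and
  \<open>\<delta> * L2 / 2\<close>, which turn the squares of the two inductor currents into
  \<delta> times their share of the energy.\<close>

lemma input_power_bound:
  assumes "\<delta> > 0"
  obtains c where "c \<ge> 0" "\<And>v U y. \<bar>v\<bar> \<le> U \<Longrightarrow> 2 * Vin * v * (y $ 1 + y $ 2) \<le> \<delta> * energy y + c * U\<^sup>2"
proof
  let ?c = "2 * Vin\<^sup>2 / (\<delta> * L1) + 2 * Vin\<^sup>2 / (\<delta> * L2)"
  show "?c \<ge> 0" using assms param_pos by simp
  fix v U :: real and y :: "real ^ 4"
  assume "\<bar>v\<bar> \<le> U"
  then have vU: "v\<^sup>2 \<le> U\<^sup>2" using abs_le_square_iff[of v U] by auto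
  have "2 * Vin * v * (y $ 1 + y $ 2) = 2 * y $ 1 * (Vin * v) + 2 * y $ 2 * (Vin * v)"
    by (simp add: algebra_simps)
  also have "\<dots> \<le> (\<delta> * L1 / 2 * (y $ 1)\<^sup>2 + (Vin * v)\<^sup>2 / (\<delta> * L1 / 2)) + (\<delta> * L2 / 2 * (y $ 2)\<^sup>2 + (Vin * v)\<^sup>2 / (\<delta> * L2 / 2))"
    using assms param_pos by (intro add_mono Young_weighted) auto
  also have "\<dots> = \<delta> * ((L1 * (y $ 1)\<^sup>2 + L2 * (y $ 2)\<^sup>2) / 2) + ?c * v\<^sup>2"
    using assms param_pos by (simp add: field_simps power2_eq_square)
  also have "\<dots> \<le> \<delta> * energy y + ?c * U\<^sup>2"
  proof (intro add_mono mult_left_mono)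
    show "(L1 * (y $ 1)\<^sup>2 + L2 * (y $ 2)\<^sup>2) / 2 \<le> energy y"
      using param_pos by (simp add: energy_def)
  qed (use assms vU \<open>?c \<ge> 0\<close> in auto)
  finally show "2 * Vin * v * (y $ 1 + y $ 2) \<le> \<delta> * energy y + ?c * U\<^sup>2" .
qed

text \<open>The energy is estimated twice: a first pass bounds its maximum over the interval, and a
  second pass puts that bound into the input term. The parameter \<eta> keeps the growth factor as
  close to 1 as later steps demand, at the expense of \<open>c\<close>.\<close>

lemma energy_dissipation:
  assumes "S > 0" "0 < \<eta>" "\<eta> \<le> 1"
  obtains c where "c \<ge> 0" "\<And>a b u x U. \<lbrakk>a \<le> b; b - a \<le> S; solution u x a b; \<And>t. a \<le> t \<Longrightarrow> t \<le> b \<Longrightarrow> \<bar>u t\<bar> \<le> U\<rbrakk>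
     \<Longrightarrow> energy (x b) + integral {a..b} (\<lambda>t. (x t $ 4)\<^sup>2) / R \<le> (1 + \<eta>) * energy (x a) + c * U\<^sup>2"
proof -
  \<comment> \<open>Gives \<open>S * \<delta> = \<eta> / 2\<close>: at most 1/2, so the maximal
    energy can be absorbed in the first pass, and doubled to exactly \<eta> in the second.\<close>
  define \<delta> where "\<delta> = \<eta> / (2 * S)"
  have \<delta>: "\<delta> > 0" "S * \<delta> = \<eta> / 2" using assms by (auto simp: \<delta>_def)
  obtain c where c: "c \<ge> 0" "\<And>v U y. \<bar>v\<bar> \<le> U \<Longrightarrow> 2 * Vin * v * (y $ 1 + y $ 2) \<le> \<delta> * energy y + c * U\<^sup>2"
    using input_power_bound[OF \<delta>(1)] by blast
  show ?thesis
  proof (rule that[of "2 * S * c"])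
    show "2 * S * c \<ge> 0" using c assms by simp
    fix a b :: real and u x U
    assume ab: "a \<le> b" "b - a \<le> S" and sol: "solution u x a b" and uU: "\<And>t. a \<le> t \<Longrightarrow> t \<le> b \<Longrightarrow> \<bar>u t\<bar> \<le> U"
    note dE = ac_deriv_energy[OF sol]
    obtain s where s: "a \<le> s" "s \<le> b" "\<And>t. a \<le> t \<Longrightarrow> t \<le> b \<Longrightarrow> energy (x t) \<le> energy (x s)"
      using continuous_attains_sup[OF compact_Icc _ ac_deriv_continuous_on[OF dE]] ab(1) by auto
    define B where "B = \<delta> * energy (x s) + c * U\<^sup>2"
    have B: "2 * Vin * u t * (x t $ 1 + x t $ 2) \<le> B" if "a \<le> t" "t \<le> b" for t
    proof -
      have "2 * Vin * u t * (x t $ 1 + x t $ 2) \<le> \<delta> * energy (x t) + c * U\<^sup>2"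
        using uU that c(2) by blast
      also have "\<dots> \<le> B"
        unfolding B_def using s(3)[OF that] \<delta> by (intro add_right_mono mult_left_mono) auto
      finally show ?thesis .
    qed
    have B0: "B \<ge> 0" unfolding B_def using \<delta> c energy_nonneg by simp
    have "energy (x s) - energy (x a) \<le> integral {a..s} (\<lambda>_. B)"
    proof (rule ac_deriv_le_integral[OF ac_deriv_subinterval[OF dE]])
      fix t assume t: "a \<le> t" "t < s"
      have "0 \<le> (x t $ 4)\<^sup>2 / R" using R_pos by simp
      then show "2 * Vin * u t * (x t $ 1 + x t $ 2) - (x t $ 4)\<^sup>2 / R \<le> B"
        using B[of t] t s by linarith
    qed (use s in auto)
    also have "\<dots> = (s - a) * B" using s by simp
    also have "\<dots> \<le> S * B" using s ab B0 by (intro mult_right_mono) auto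
    also have "\<dots> = \<eta> / 2 * energy (x s) + S * c * U\<^sup>2"
      using \<delta>(2) by (simp add: B_def distrib_left mult.assoc[symmetric])
    also have "\<dots> \<le> 1 / 2 * energy (x s) + S * c * U\<^sup>2"
      using assms energy_nonneg by (intro add_right_mono mult_right_mono) auto
    \<comment> \<open>Half of \<open>energy (x s)\<close> has been moved to the left-hand side,
      whence both factors 2.\<close>
    finally have sup: "energy (x s) \<le> 2 * energy (x a) + 2 * S * c * U\<^sup>2" by simp
    have int4: "(\<lambda>t. (x t $ 4)\<^sup>2) integrable_on {a..b}"
      by (intro integrable_continuous_interval continuous_intros solution_continuous_on[OF sol])
    have "energy (x b) - energy (x a) \<le> integral {a..b} (\<lambda>t. B - (x t $ 4)\<^sup>2 / R)"
    proof (rule ac_deriv_le_integral[OF dE ab(1)])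
      fix t assume t: "a \<le> t" "t < b"
      show "2 * Vin * u t * (x t $ 1 + x t $ 2) - (x t $ 4)\<^sup>2 / R \<le> B - (x t $ 4)\<^sup>2 / R"
        using B[of t] t by simp
    next
      show "(\<lambda>t. B - (x t $ 4)\<^sup>2 / R) integrable_on {a..b}"
        using R_pos by (intro integrable_continuous_interval continuous_intros solution_continuous_on[OF sol]) auto
    qed
    also have "\<dots> = (b - a) * B - integral {a..b} (\<lambda>t. (x t $ 4)\<^sup>2) / R"
      using int4 ab(1) by (subst integral_diff) (auto simp: integrable_const_ivl intro!: integrable_on_divide)
    also have "(b - a) * B \<le> S * B" using ab B0 by (intro mult_right_mono) auto
    also have "S * B = \<eta> / 2 * energy (x s) + S * c * U\<^sup>2"
      using \<delta>(2) by (simp add: B_def distrib_left mult.assoc[symmetric])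
    also have "\<eta> / 2 * energy (x s) \<le> \<eta> / 2 * (2 * energy (x a) + 2 * S * c * U\<^sup>2)"
      using sup assms by (intro mult_left_mono) auto
    also have "\<dots> = \<eta> * energy (x a) + \<eta> * (S * c * U\<^sup>2)" by (simp add: algebra_simps)
    also have "\<eta> * (S * c * U\<^sup>2) \<le> 1 * (S * c * U\<^sup>2)"
      using assms c by (intro mult_right_mono) auto
    finally show "energy (x b) + integral {a..b} (\<lambda>t. (x t $ 4)\<^sup>2) / R \<le> (1 + \<eta>) * energy (x a) + 2 * S * c * U\<^sup>2"
      by (simp add: algebra_simps)
  qed
qed

section \<open>Recovering three states from the load voltage in mode 1/2\<close>

text \<open>
  Given \<open>\<beta>\<close>, the coefficients of \<open>x\<^sub>2\<close> and \<open>x\<^sub>4\<close> in \<open>F\<close> are chosen so that \<open>x\<^sub>2\<close> and \<open>x\<^sub>3\<close> cancel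
  in the derivative of \<open>F\<close> along solutions with \<open>\<mu> = 1/2\<close>, leaving only \<open>x\<^sub>4\<close> and the input.
\<close>

lemma multiplier_bound:
  assumes "\<epsilon> > 0"
    and d0: "\<And>w. (\<beta> has_real_derivative \<beta>1 w) (at w)"
    and d1: "\<And>w. (\<beta>1 has_real_derivative \<beta>2 w) (at w)"
    and d2: "\<And>w. (\<beta>2 has_real_derivative \<beta>3 w) (at w)"
    and cont: "continuous_on {0..\<epsilon>} \<beta>3"
  defines "F \<equiv> \<lambda>w y. - L2 * \<beta>1 w * (y $ 2) + \<beta> w * (y $ 3) - C2 * (L2 * \<beta>2 w + \<beta> w / C1) * (y $ 4)"
  obtains C where "C > 0" "\<And>p u x U. \<lbrakk>solution u x p (p + \<epsilon>); \<And>t. p \<le> t \<Longrightarrow> t < p + \<epsilon> \<Longrightarrow> \<mu> t = 1/2;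
      \<And>t. p \<le> t \<Longrightarrow> t \<le> p + \<epsilon> \<Longrightarrow> \<bar>u t\<bar> \<le> U\<rbrakk>
      \<Longrightarrow> \<bar>F \<epsilon> (x (p + \<epsilon>)) - F 0 (x p)\<bar> \<le> C * (integral {p..p + \<epsilon>} (\<lambda>t. \<bar>x t $ 4\<bar>) + U)"
proof -
  \<comment> \<open>The coefficient that \<open>x\<^sub>4\<close> retains in the derivative of
    \<open>F\<close>: the three contributions come from differentiating the weight of
    \<open>x\<^sub>4\<close>, from the equation of \<open>x\<^sub>2\<close>, and from the load term
    in the equation of \<open>x\<^sub>4\<close>.\<close>
  define h where "h w = - C2 * (L2 * \<beta>3 w + \<beta>1 w / C1) - \<beta>1 w + (L2 * \<beta>2 w + \<beta> w / C1) / R" for w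
  have cb: "continuous_on A \<beta>" "continuous_on A \<beta>1" "continuous_on A \<beta>2" for A
    using d0 d1 d2 by (meson DERIV_continuous_on has_field_derivative_at_within)+
  have "continuous_on {0..\<epsilon>} h"
    unfolding h_def using param_pos by (intro continuous_intros cb cont) auto
  then obtain H where H: "H > 0" "\<And>w. 0 \<le> w \<Longrightarrow> w \<le> \<epsilon> \<Longrightarrow> \<bar>h w\<bar> \<le> H"
    using continuous_on_Icc_bounded by blast
  obtain K where K: "K > 0" "\<And>w. 0 \<le> w \<Longrightarrow> w \<le> \<epsilon> \<Longrightarrow> \<bar>\<beta>1 w\<bar> \<le> K"
    using continuous_on_Icc_bounded[OF cb(2)] by blast
  show ?thesis
  proof (rule that[of "H + K * (2 * \<bar>Vin\<bar>) * \<epsilon>"])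
    show "H + K * (2 * \<bar>Vin\<bar>) * \<epsilon> > 0" using H K assms(1) by (simp add: add_pos_nonneg)
    fix p u x U
    assume sol: "solution u x p (p + \<epsilon>)" and mu: "\<And>t. p \<le> t \<Longrightarrow> t < p + \<epsilon> \<Longrightarrow> \<mu> t = 1/2"
      and uU: "\<And>t. p \<le> t \<Longrightarrow> t \<le> p + \<epsilon> \<Longrightarrow> \<bar>u t\<bar> \<le> U"
    let ?q = "p + \<epsilon>"
    have U0: "U \<ge> 0" using uU[of p] assms(1) by auto
    note s = sol[unfolded solution_def]
    \<comment> \<open>The weights live on \<open>{0..\<epsilon>}\<close> and are translated to start
      at \<open>p\<close>, so their bounds, and with them the constant, do not depend on
      \<open>p\<close>.\<close>
    have shift: "((\<lambda>t. g (t - p)) has_real_derivative g' (t - p)) (at t)"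
      if "\<And>w. (g has_real_derivative g' w) (at w)" for g g' :: "real \<Rightarrow> real" and t
    proof -
      have "((\<lambda>t. t - p) has_real_derivative 1) (at t)" by (auto intro!: derivative_eq_intros)
      from DERIV_chain2[OF that this] show ?thesis by simp
    qed
    have a0: "ac_deriv (\<lambda>t. \<beta> (t - p)) (\<lambda>t. \<beta>1 (t - p)) p ?q"
      by (rule ac_deriv_C1[OF shift[OF d0]]) (auto intro!: continuous_on_compose2[OF cb(2)[of UNIV]] continuous_intros)
    have a1: "ac_deriv (\<lambda>t. \<beta>1 (t - p)) (\<lambda>t. \<beta>2 (t - p)) p ?q"
      by (rule ac_deriv_C1[OF shift[OF d1]]) (auto intro!: continuous_on_compose2[OF cb(3)[of UNIV]] continuous_intros)
    have a2: "ac_deriv (\<lambda>t. \<beta>2 (t - p)) (\<lambda>t. \<beta>3 (t - p)) p ?q"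
      by (rule ac_deriv_C1[OF shift[OF d2]]) (auto intro!: continuous_on_compose2[OF cont] continuous_intros)
    have x2: "ac_deriv (\<lambda>t. x t $ 2) (\<lambda>t. (x t $ 3 + x t $ 4 + 2 * Vin * u t) / L2) p ?q"
      by (rule ac_deriv_cong[OF s[THEN conjunct2, THEN conjunct1]]) (simp add: mu)
    have x3: "ac_deriv (\<lambda>t. x t $ 3) (\<lambda>t. - x t $ 2 / C1) p ?q"
      by (rule ac_deriv_cong[OF s[THEN conjunct2, THEN conjunct2, THEN conjunct1]]) (simp add: mu)
    note x4 = s[THEN conjunct2, THEN conjunct2, THEN conjunct2]
    have F: "ac_deriv (\<lambda>t. F (t - p) (x t)) (\<lambda>t. h (t - p) * x t $ 4 - \<beta>1 (t - p) * (2 * Vin * u t)) p ?q"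
    proof -
      have e: "(\<lambda>t. F (t - p) (x t)) = (\<lambda>t. (-L2) * (\<beta>1 (t - p) * x t $ 2) + \<beta> (t - p) * x t $ 3 +
         (-C2) * ((L2 * \<beta>2 (t - p) + 1 / C1 * \<beta> (t - p)) * x t $ 4))"
        by (rule ext) (simp add: F_def)
      show ?thesis
        unfolding e
        by (rule ac_deriv_cong[OF ac_deriv_add[OF ac_deriv_add[OF ac_deriv_cmult[OF ac_deriv_mult[OF a1 x2]] ac_deriv_mult[OF a0 x3]]
              ac_deriv_cmult[OF ac_deriv_mult[OF ac_deriv_add[OF ac_deriv_cmult[OF a2] ac_deriv_cmult[OF a0]] x4]]]])
           (use param_pos in \<open>simp add: h_def field_simps\<close>)
    qed
    have ci: "(\<lambda>t. \<bar>x t $ 4\<bar>) integrable_on {p..?q}"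
      by (intro integrable_continuous_interval continuous_intros solution_continuous_on[OF sol])
    have "\<bar>F (?q - p) (x ?q) - F (p - p) (x p)\<bar> \<le> integral {p..?q} (\<lambda>t. H * \<bar>x t $ 4\<bar> + K * (2 * \<bar>Vin\<bar> * U))"
    proof (rule ac_deriv_abs_le_integral[OF F])
      fix t assume t: "p \<le> t" "t < ?q"
      have "\<bar>h (t - p) * x t $ 4 - \<beta>1 (t - p) * (2 * Vin * u t)\<bar> \<le> \<bar>h (t - p)\<bar> * \<bar>x t $ 4\<bar> + \<bar>\<beta>1 (t - p)\<bar> * (2 * \<bar>Vin\<bar> * \<bar>u t\<bar>)"
        by (rule order_trans[OF abs_triangle_ineq4]) (simp add: abs_mult)
      also have "\<dots> \<le> H * \<bar>x t $ 4\<bar> + K * (2 * \<bar>Vin\<bar> * U)"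
        using H K U0 uU[of t] t by (intro add_mono mult_mono) auto
      finally show "\<bar>h (t - p) * x t $ 4 - \<beta>1 (t - p) * (2 * Vin * u t)\<bar> \<le> H * \<bar>x t $ 4\<bar> + K * (2 * \<bar>Vin\<bar> * U)" .
    next
      show "(\<lambda>t. H * \<bar>x t $ 4\<bar> + K * (2 * \<bar>Vin\<bar> * U)) integrable_on {p..?q}"
        by (intro integrable_continuous_interval continuous_intros solution_continuous_on[OF sol])
    qed (use assms(1) in auto)
    also have "\<dots> = H * integral {p..?q} (\<lambda>t. \<bar>x t $ 4\<bar>) + \<epsilon> * (K * (2 * \<bar>Vin\<bar> * U))"
      using ci assms(1) integrable_on_mult_right[OF ci] by (subst integral_add) (auto simp: integrable_const_ivl)
    also have "\<dots> \<le> (H + K * (2 * \<bar>Vin\<bar>) * \<epsilon>) * integral {p..?q} (\<lambda>t. \<bar>x t $ 4\<bar>) + (H + K * (2 * \<bar>Vin\<bar>) * \<epsilon>) * U"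
    proof (rule add_mono)
      have "0 \<le> integral {p..?q} (\<lambda>t. \<bar>x t $ 4\<bar>)" by (rule integral_nonneg[OF ci]) simp
      then show "H * integral {p..?q} (\<lambda>t. \<bar>x t $ 4\<bar>) \<le> (H + K * (2 * \<bar>Vin\<bar>) * \<epsilon>) * integral {p..?q} (\<lambda>t. \<bar>x t $ 4\<bar>)"
        using K assms(1) by (intro mult_right_mono) auto
      have "\<epsilon> * (K * (2 * \<bar>Vin\<bar> * U)) = (K * (2 * \<bar>Vin\<bar>) * \<epsilon>) * U" by (simp add: ac_simps)
      also have "\<dots> \<le> (H + K * (2 * \<bar>Vin\<bar>) * \<epsilon>) * U" using H U0 by (intro mult_right_mono) auto
      finally show "\<epsilon> * (K * (2 * \<bar>Vin\<bar> * U)) \<le> (H + K * (2 * \<bar>Vin\<bar>) * \<epsilon>) * U" .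
    qed
    finally show "\<bar>F \<epsilon> (x ?q) - F 0 (x p)\<bar> \<le> (H + K * (2 * \<bar>Vin\<bar>) * \<epsilon>) * (integral {p..?q} (\<lambda>t. \<bar>x t $ 4\<bar>) + U)"
      by (simp add: distrib_left)
  qed
qed

text \<open>The multiplier vanishes to third order at the endpoint \<open>z\<close>, so only the
  boundary term at the opposite endpoint \<open>y\<close> is left. Both orientations are wanted: the
  right end for the interval before a switch to mode -1/2, the left end for the interval after the
  return.\<close>

lemma multiplier_endpoint_bound:
  assumes "\<epsilon> > 0" and y: "y = 0 \<and> z = \<epsilon> \<or> y = \<epsilon> \<and> z = 0"
    and d0: "\<And>w. (\<beta> has_real_derivative \<beta>1 w) (at w)"
    and d1: "\<And>w. (\<beta>1 has_real_derivative \<beta>2 w) (at w)"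
    and d2: "\<And>w. (\<beta>2 has_real_derivative \<beta>3 w) (at w)"
    and cont: "continuous_on {0..\<epsilon>} \<beta>3"
    and zero: "\<beta> z = 0" "\<beta>1 z = 0" "\<beta>2 z = 0"
  obtains C where "C > 0" "\<And>p u x U. \<lbrakk>solution u x p (p + \<epsilon>); \<And>t. p \<le> t \<Longrightarrow> t < p + \<epsilon> \<Longrightarrow> \<mu> t = 1/2;
      \<And>t. p \<le> t \<Longrightarrow> t \<le> p + \<epsilon> \<Longrightarrow> \<bar>u t\<bar> \<le> U\<rbrakk>
      \<Longrightarrow> \<bar>- L2 * \<beta>1 y * (x (p + y) $ 2) + \<beta> y * (x (p + y) $ 3) - C2 * (L2 * \<beta>2 y + \<beta> y / C1) * (x (p + y) $ 4)\<bar>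
         \<le> C * (integral {p..p + \<epsilon>} (\<lambda>t. \<bar>x t $ 4\<bar>) + U)"
proof -
  obtain C where C: "C > 0" "\<And>p u x U. \<lbrakk>solution u x p (p + \<epsilon>); \<And>t. p \<le> t \<Longrightarrow> t < p + \<epsilon> \<Longrightarrow> \<mu> t = 1/2;
      \<And>t. p \<le> t \<Longrightarrow> t \<le> p + \<epsilon> \<Longrightarrow> \<bar>u t\<bar> \<le> U\<rbrakk>
      \<Longrightarrow> \<bar>- L2 * \<beta>1 \<epsilon> * (x (p + \<epsilon>) $ 2) + \<beta> \<epsilon> * (x (p + \<epsilon>) $ 3) - C2 * (L2 * \<beta>2 \<epsilon> + \<beta> \<epsilon> / C1) * (x (p + \<epsilon>) $ 4)
        - (- L2 * \<beta>1 0 * (x p $ 2) + \<beta> 0 * (x p $ 3) - C2 * (L2 * \<beta>2 0 + \<beta> 0 / C1) * (x p $ 4))\<bar>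
       \<le> C * (integral {p..p + \<epsilon>} (\<lambda>t. \<bar>x t $ 4\<bar>) + U)"
    using multiplier_bound[OF assms(1) d0 d1 d2 cont] by blast
  show ?thesis
  proof (rule that[OF C(1)])
    fix p u x U
    assume *: "solution u x p (p + \<epsilon>)" "\<And>t. p \<le> t \<Longrightarrow> t < p + \<epsilon> \<Longrightarrow> \<mu> t = 1/2"
      "\<And>t. p \<le> t \<Longrightarrow> t \<le> p + \<epsilon> \<Longrightarrow> \<bar>u t\<bar> \<le> U"
    from y show "\<bar>- L2 * \<beta>1 y * (x (p + y) $ 2) + \<beta> y * (x (p + y) $ 3) - C2 * (L2 * \<beta>2 y + \<beta> y / C1) * (x (p + y) $ 4)\<bar>
         \<le> C * (integral {p..p + \<epsilon>} (\<lambda>t. \<bar>x t $ 4\<bar>) + U)"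
    proof
      assume "y = 0 \<and> z = \<epsilon>"
      then show ?thesis using C(2)[OF *] zero by (simp add: abs_minus_commute)
    next
      assume "y = \<epsilon> \<and> z = 0"
      then show ?thesis using C(2)[OF *] zero by simp
    qed
  qed
qed

text \<open>
  The multipliers \<open>(w - z)\<^sup>3 (w - y)\<^sup>k\<close>, \<open>k = 2, 1, 0\<close>, vanish to third order at \<open>z\<close>, and their
  2-jets at \<open>y\<close> are triangular, so they isolate \<open>x\<^sub>4\<close>, \<open>x\<^sub>2\<close> and \<open>x\<^sub>3\<close> at \<open>y\<close> in turn.
\<close>

lemma observability:
  assumes "\<epsilon> > 0" and y: "y = 0 \<or> y = \<epsilon>"
  obtains C where "C > 0" "\<And>p u x U i. \<lbrakk>solution u x p (p + \<epsilon>); \<And>t. p \<le> t \<Longrightarrow> t < p + \<epsilon> \<Longrightarrow> \<mu> t = 1/2;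
      \<And>t. p \<le> t \<Longrightarrow> t \<le> p + \<epsilon> \<Longrightarrow> \<bar>u t\<bar> \<le> U; i \<in> {2, 3, 4}\<rbrakk>
      \<Longrightarrow> \<bar>x (p + y) $ i\<bar> \<le> C * (integral {p..p + \<epsilon>} (\<lambda>t. \<bar>x t $ 4\<bar>) + U)"
proof -
  \<comment> \<open>\<open>z\<close> is the endpoint opposite to \<open>y\<close>, and
    \<open>d\<close> is \<epsilon> or its negative; the sign disappears in the absolute values
    below.\<close>
  define z where "z = \<epsilon> - y"
  define d where "d = y - z"
  have yz: "y = 0 \<and> z = \<epsilon> \<or> y = \<epsilon> \<and> z = 0" using y by (auto simp: z_def)
  have d: "\<bar>d\<bar> = \<epsilon>" using yz assms(1) by (auto simp: d_def)
  \<comment> \<open>The values of the multiplier and its first two derivatives at \<open>y\<close>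
    are (0, 0, 2 d^3) here, then (0, d^3, 6 d^2), and finally (d^3, 3 d^2, 6 d).\<close>
  obtain K2 where K2: "K2 > 0" "\<And>p u x U. \<lbrakk>solution u x p (p + \<epsilon>); \<And>t. p \<le> t \<Longrightarrow> t < p + \<epsilon> \<Longrightarrow> \<mu> t = 1/2;
      \<And>t. p \<le> t \<Longrightarrow> t \<le> p + \<epsilon> \<Longrightarrow> \<bar>u t\<bar> \<le> U\<rbrakk>
      \<Longrightarrow> \<bar>- (C2 * (L2 * (2 * d ^ 3)) * x (p + y) $ 4)\<bar> \<le> K2 * (integral {p..p + \<epsilon>} (\<lambda>t. \<bar>x t $ 4\<bar>) + U)"
    by (rule multiplier_endpoint_bound[OF assms(1) yz,
      of "\<lambda>w. (w - z) ^ 3 * (w - y)\<^sup>2"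
         "\<lambda>w. 3 * (w - z)\<^sup>2 * (w - y)\<^sup>2 + 2 * (w - z) ^ 3 * (w - y)"
         "\<lambda>w. 6 * (w - z) * (w - y)\<^sup>2 + 12 * (w - z)\<^sup>2 * (w - y) + 2 * (w - z) ^ 3"
         "\<lambda>w. 6 * (w - y)\<^sup>2 + 36 * (w - z) * (w - y) + 18 * (w - z)\<^sup>2"])
       (auto intro!: derivative_eq_intros continuous_intros simp: algebra_simps power2_eq_square power3_eq_cube d_def)
  obtain K1 where K1: "K1 > 0" "\<And>p u x U. \<lbrakk>solution u x p (p + \<epsilon>); \<And>t. p \<le> t \<Longrightarrow> t < p + \<epsilon> \<Longrightarrow> \<mu> t = 1/2;
      \<And>t. p \<le> t \<Longrightarrow> t \<le> p + \<epsilon> \<Longrightarrow> \<bar>u t\<bar> \<le> U\<rbrakk>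
      \<Longrightarrow> \<bar>- (L2 * d ^ 3 * x (p + y) $ 2) - C2 * (L2 * (6 * d\<^sup>2)) * x (p + y) $ 4\<bar> \<le> K1 * (integral {p..p + \<epsilon>} (\<lambda>t. \<bar>x t $ 4\<bar>) + U)"
    by (rule multiplier_endpoint_bound[OF assms(1) yz,
      of "\<lambda>w. (w - z) ^ 3 * (w - y)"
         "\<lambda>w. 3 * (w - z)\<^sup>2 * (w - y) + (w - z) ^ 3"
         "\<lambda>w. 6 * (w - z) * (w - y) + 6 * (w - z)\<^sup>2"
         "\<lambda>w. 6 * (w - y) + 18 * (w - z)"])
       (auto intro!: derivative_eq_intros continuous_intros simp: algebra_simps power2_eq_square power3_eq_cube d_def)
  obtain K0 where K0: "K0 > 0" "\<And>p u x U. \<lbrakk>solution u x p (p + \<epsilon>); \<And>t. p \<le> t \<Longrightarrow> t < p + \<epsilon> \<Longrightarrow> \<mu> t = 1/2;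
      \<And>t. p \<le> t \<Longrightarrow> t \<le> p + \<epsilon> \<Longrightarrow> \<bar>u t\<bar> \<le> U\<rbrakk>
      \<Longrightarrow> \<bar>- (L2 * (3 * d\<^sup>2) * x (p + y) $ 2) + d ^ 3 * x (p + y) $ 3 - C2 * (L2 * (6 * d) + d ^ 3 / C1) * x (p + y) $ 4\<bar>
        \<le> K0 * (integral {p..p + \<epsilon>} (\<lambda>t. \<bar>x t $ 4\<bar>) + U)"
    by (rule multiplier_endpoint_bound[OF assms(1) yz,
      of "\<lambda>w. (w - z) ^ 3" "\<lambda>w. 3 * (w - z)\<^sup>2" "\<lambda>w. 6 * (w - z)" "\<lambda>w. 6"])
       (auto intro!: derivative_eq_intros continuous_intros simp: algebra_simps power2_eq_square power3_eq_cube d_def)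
  \<comment> \<open>Back substitution in the triangular system: each constant adds the bounds
    already obtained for the other components and divides by the modulus of the leading
    coefficient.\<close>
  define m4 where "m4 = K2 / (C2 * (L2 * (2 * \<epsilon> ^ 3)))"
  define m2 where "m2 = (K1 + C2 * (L2 * (6 * \<epsilon>\<^sup>2)) * m4) / (L2 * \<epsilon> ^ 3)"
  define m3 where "m3 = (K0 + L2 * (3 * \<epsilon>\<^sup>2) * m2 + C2 * (L2 * (6 * \<epsilon>) + \<epsilon> ^ 3 / C1) * m4) / \<epsilon> ^ 3"
  have m: "m4 > 0" "m2 > 0" "m3 > 0"
  proof -
    show m4: "m4 > 0" using K2(1) param_pos assms(1) by (simp add: m4_def)
    show m2: "m2 > 0" unfolding m2_def using K1(1) param_pos assms(1) m4
      by (intro divide_pos_pos add_pos_pos mult_pos_pos) auto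
    show "m3 > 0" unfolding m3_def using K0(1) param_pos assms(1) m4 m2
      by (intro divide_pos_pos add_pos_pos mult_pos_pos) auto
  qed
  show ?thesis
  proof (rule that[of "m2 + m3 + m4"])
    show "m2 + m3 + m4 > 0" using m by simp
    fix p u x U and i :: 4
    assume *: "solution u x p (p + \<epsilon>)" "\<And>t. p \<le> t \<Longrightarrow> t < p + \<epsilon> \<Longrightarrow> \<mu> t = 1/2"
      "\<And>t. p \<le> t \<Longrightarrow> t \<le> p + \<epsilon> \<Longrightarrow> \<bar>u t\<bar> \<le> U" and i: "i \<in> {2, 3, 4}"
    define Q where "Q = integral {p..p + \<epsilon>} (\<lambda>t. \<bar>x t $ 4\<bar>) + U"
    have "0 \<le> integral {p..p + \<epsilon>} (\<lambda>t. \<bar>x t $ 4\<bar>)"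
      by (intro integral_nonneg integrable_continuous_interval continuous_intros solution_continuous_on[OF *(1)]) simp
    moreover have "U \<ge> 0" using *(3)[of p] assms(1) by auto
    ultimately have Q: "Q \<ge> 0" by (simp add: Q_def)
    let ?X = "x (p + y)"
    have "C2 * (L2 * (2 * \<epsilon> ^ 3)) * \<bar>?X $ 4\<bar> = \<bar>- (C2 * (L2 * (2 * d ^ 3)) * ?X $ 4)\<bar>"
      using param_pos by (simp add: abs_mult power_abs d)
    also have "\<dots> \<le> K2 * Q" unfolding Q_def by (rule K2(2)[OF *])
    finally have x4: "\<bar>?X $ 4\<bar> \<le> m4 * Q"
      using param_pos assms(1) by (simp add: m4_def field_simps)
    have "L2 * \<epsilon> ^ 3 * \<bar>?X $ 2\<bar> = \<bar>- (L2 * d ^ 3 * ?X $ 2)\<bar>"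
      using param_pos by (simp add: abs_mult power_abs d)
    also have "\<dots> \<le> \<bar>- (L2 * d ^ 3 * ?X $ 2) - C2 * (L2 * (6 * d\<^sup>2)) * ?X $ 4\<bar> + \<bar>C2 * (L2 * (6 * d\<^sup>2)) * ?X $ 4\<bar>"
      by linarith
    also have "\<dots> \<le> K1 * Q + C2 * (L2 * (6 * \<epsilon>\<^sup>2)) * (m4 * Q)"
    proof (rule add_mono)
      show "\<bar>- (L2 * d ^ 3 * ?X $ 2) - C2 * (L2 * (6 * d\<^sup>2)) * ?X $ 4\<bar> \<le> K1 * Q"
        unfolding Q_def by (rule K1(2)[OF *])
      have "\<bar>C2 * (L2 * (6 * d\<^sup>2)) * ?X $ 4\<bar> = C2 * (L2 * (6 * \<epsilon>\<^sup>2)) * \<bar>?X $ 4\<bar>"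
        using param_pos d[symmetric] by (simp add: abs_mult)
      also have "\<dots> \<le> C2 * (L2 * (6 * \<epsilon>\<^sup>2)) * (m4 * Q)"
        using x4 param_pos by (intro mult_left_mono) auto
      finally show "\<bar>C2 * (L2 * (6 * d\<^sup>2)) * ?X $ 4\<bar> \<le> C2 * (L2 * (6 * \<epsilon>\<^sup>2)) * (m4 * Q)" .
    qed
    finally have x2: "\<bar>?X $ 2\<bar> \<le> m2 * Q"
      using param_pos assms(1) by (simp add: m2_def pos_le_divide_eq algebra_simps)
    have "\<epsilon> ^ 3 * \<bar>?X $ 3\<bar> = \<bar>d ^ 3 * ?X $ 3\<bar>"
      by (simp add: abs_mult power_abs d)
    also have "\<dots> \<le> \<bar>- (L2 * (3 * d\<^sup>2) * ?X $ 2) + d ^ 3 * ?X $ 3 - C2 * (L2 * (6 * d) + d ^ 3 / C1) * ?X $ 4\<bar>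
        + \<bar>L2 * (3 * d\<^sup>2) * ?X $ 2\<bar> + \<bar>C2 * (L2 * (6 * d) + d ^ 3 / C1) * ?X $ 4\<bar>"
      by linarith
    also have "\<dots> \<le> K0 * Q + L2 * (3 * \<epsilon>\<^sup>2) * (m2 * Q) + C2 * (L2 * (6 * \<epsilon>) + \<epsilon> ^ 3 / C1) * (m4 * Q)"
    proof (intro add_mono)
      show "\<bar>- (L2 * (3 * d\<^sup>2) * ?X $ 2) + d ^ 3 * ?X $ 3 - C2 * (L2 * (6 * d) + d ^ 3 / C1) * ?X $ 4\<bar> \<le> K0 * Q"
        unfolding Q_def by (rule K0(2)[OF *])
      have "\<bar>L2 * (3 * d\<^sup>2) * ?X $ 2\<bar> = L2 * (3 * \<epsilon>\<^sup>2) * \<bar>?X $ 2\<bar>"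
        using param_pos d[symmetric] by (simp add: abs_mult)
      also have "\<dots> \<le> L2 * (3 * \<epsilon>\<^sup>2) * (m2 * Q)"
        using x2 param_pos by (intro mult_left_mono) auto
      finally show "\<bar>L2 * (3 * d\<^sup>2) * ?X $ 2\<bar> \<le> L2 * (3 * \<epsilon>\<^sup>2) * (m2 * Q)" .
      have "\<bar>L2 * (6 * d) + d ^ 3 / C1\<bar> \<le> L2 * (6 * \<bar>d\<bar>) + \<bar>d\<bar> ^ 3 / C1"
        using param_pos by (intro order_trans[OF abs_triangle_ineq]) (simp add: abs_mult power_abs)
      then show "\<bar>C2 * (L2 * (6 * d) + d ^ 3 / C1) * ?X $ 4\<bar> \<le> C2 * (L2 * (6 * \<epsilon>) + \<epsilon> ^ 3 / C1) * (m4 * Q)"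
        unfolding d abs_mult using x4 param_pos assms(1) by (intro mult_mono) auto
    qed
    finally have x3: "\<bar>?X $ 3\<bar> \<le> m3 * Q"
      using param_pos assms(1) by (simp add: m3_def pos_le_divide_eq algebra_simps)
    have "m2 * Q \<le> (m2 + m3 + m4) * Q" "m3 * Q \<le> (m2 + m3 + m4) * Q" "m4 * Q \<le> (m2 + m3 + m4) * Q"
      using m Q by (auto intro!: mult_right_mono)
    with x2 x3 x4 i show "\<bar>?X $ i\<bar> \<le> (m2 + m3 + m4) * (integral {p..p + \<epsilon>} (\<lambda>t. \<bar>x t $ 4\<bar>) + U)"
      unfolding Q_def by auto
  qed
qed

section \<open>Recovering the first inductor current in mode -1/2\<close>

text \<open>Rotating \<open>(x\<^sub>1, x\<^sub>3)\<close> back along the free oscillation gives a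
  quantity driven by the input alone. Comparing its values at \<open>p\<close> and \<open>q\<close>
  expresses \<open>sin (\<omega> * (q - p))\<close> times \<open>x\<^sub>1\<close> at
  \<open>p\<close> through the two values of \<open>x\<^sub>3\<close>, and the sine stays away from
  0 because \<open>T\<close> is below the half-period.\<close>

lemma decoupled_oscillator_bound:
  assumes "0 < \<epsilon>" "2 * \<epsilon> \<le> T" "T < pi * sqrt (L1 * C1)"
  obtains C where "C > 0" "\<And>p q u x U. \<lbrakk>p + \<epsilon> \<le> q; q \<le> p + T - \<epsilon>; solution u x p q; \<And>t. p \<le> t \<Longrightarrow> t < q \<Longrightarrow> \<mu> t = -1/2;
      \<And>t. p \<le> t \<Longrightarrow> t \<le> q \<Longrightarrow> \<bar>u t\<bar> \<le> U\<rbrakk>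
      \<Longrightarrow> \<bar>x p $ 1\<bar> \<le> C * (\<bar>x p $ 3\<bar> + \<bar>x q $ 3\<bar> + U)"
proof -
  define \<omega> where "\<omega> = 1 / sqrt (L1 * C1)"
  have \<omega>: "\<omega> > 0" "L1 * \<omega>\<^sup>2 = 1 / C1" "\<omega> * T < pi"
  proof -
    have r: "sqrt (L1 * C1) > 0" using param_pos by simp
    then show "\<omega> > 0" by (simp add: \<omega>_def)
    have "(sqrt (L1 * C1))\<^sup>2 = L1 * C1" using param_pos by simp
    then show "L1 * \<omega>\<^sup>2 = 1 / C1" using param_pos by (simp add: \<omega>_def power_divide)
    show "\<omega> * T < pi" using assms(3) r by (simp add: \<omega>_def pos_divide_less_eq)
  qed
  \<comment> \<open>The sine attains a minimum over all admissible durations of the mode; its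
    positivity makes the constant uniform in the switching instant.\<close>
  have "\<exists>s0\<in>{\<epsilon>..T - \<epsilon>}. \<forall>s\<in>{\<epsilon>..T - \<epsilon>}. sin (\<omega> * s0) \<le> sin (\<omega> * s)"
    by (rule continuous_attains_inf) (use assms(2) in \<open>auto intro!: continuous_intros\<close>)
  then obtain s0 where s0: "s0 \<in> {\<epsilon>..T - \<epsilon>}" "\<And>s. s \<in> {\<epsilon>..T - \<epsilon>} \<Longrightarrow> sin (\<omega> * s0) \<le> sin (\<omega> * s)"
    by blast
  define m where "m = sin (\<omega> * s0)"
  have m: "m > 0" unfolding m_def
  proof (rule sin_gt_zero)
    show "0 < \<omega> * s0" using \<omega> s0 assms by simp
    have "\<omega> * s0 \<le> \<omega> * T" using \<omega> s0 assms by simp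
    then show "\<omega> * s0 < pi" using \<omega>(3) by linarith
  qed
  let ?C = "(1 + \<omega> * (2 * \<bar>Vin\<bar>) * T) / (L1 * \<omega> * m)"
  show ?thesis
  proof (rule that[of ?C])
    have T0: "T > 0" using assms by simp
    then show "?C > 0" using \<omega> m L1_pos by (intro divide_pos_pos add_pos_nonneg mult_pos_pos) auto
    fix p q u x U
    assume pq: "p + \<epsilon> \<le> q" "q \<le> p + T - \<epsilon>" and sol: "solution u x p q"
      and mu: "\<And>t. p \<le> t \<Longrightarrow> t < q \<Longrightarrow> \<mu> t = -1/2" and uU: "\<And>t. p \<le> t \<Longrightarrow> t \<le> q \<Longrightarrow> \<bar>u t\<bar> \<le> U"
    have U0: "U \<ge> 0" using uU[of p] pq assms(1) by auto
    note s = sol[unfolded solution_def]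
    have x1: "ac_deriv (\<lambda>t. x t $ 1) (\<lambda>t. (2 * Vin * u t - x t $ 3) / L1) p q"
      by (rule ac_deriv_cong[OF s[THEN conjunct1]]) (simp add: mu)
    have x3: "ac_deriv (\<lambda>t. x t $ 3) (\<lambda>t. x t $ 1 / C1) p q"
      by (rule ac_deriv_cong[OF s[THEN conjunct2, THEN conjunct2, THEN conjunct1]]) (simp add: mu)
    have sn: "ac_deriv (\<lambda>t. - L1 * \<omega> * sin (\<omega> * (t - q))) (\<lambda>t. - (L1 * \<omega>\<^sup>2) * cos (\<omega> * (t - q))) p q"
      by (rule ac_deriv_C1) (auto intro!: derivative_eq_intros continuous_intros simp: power2_eq_square)
    have cs: "ac_deriv (\<lambda>t. cos (\<omega> * (t - q))) (\<lambda>t. - \<omega> * sin (\<omega> * (t - q))) p q"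
      by (rule ac_deriv_C1) (auto intro!: derivative_eq_intros continuous_intros)
    \<comment> \<open>The phase is zero at \<open>q\<close>, so \<open>F q\<close> is just
      \<open>x\<^sub>3\<close> there. The choice \<open>L1 * \<omega>\<^sup>2 = 1 / C1\<close>
      cancels \<open>x\<^sub>1\<close> in the derivative, and \<open>x\<^sub>3\<close> cancels by
      the choice of weights.\<close>
    define F where "F t = - L1 * \<omega> * sin (\<omega> * (t - q)) * x t $ 1 + cos (\<omega> * (t - q)) * x t $ 3" for t
    have F: "ac_deriv F (\<lambda>t. - \<omega> * sin (\<omega> * (t - q)) * (2 * Vin * u t)) p q"
      unfolding F_def
      by (rule ac_deriv_cong[OF ac_deriv_add[OF ac_deriv_mult[OF sn x1] ac_deriv_mult[OF cs x3]]])
         (use \<omega>(2) param_pos in \<open>simp add: field_simps\<close>)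
    have "\<bar>F q - F p\<bar> \<le> integral {p..q} (\<lambda>_. \<omega> * (2 * \<bar>Vin\<bar> * U))"
    proof (rule ac_deriv_abs_le_integral[OF F])
      fix t assume t: "p \<le> t" "t < q"
      have "\<bar>- \<omega> * sin (\<omega> * (t - q)) * (2 * Vin * u t)\<bar> = \<omega> * (\<bar>sin (\<omega> * (t - q))\<bar> * (2 * \<bar>Vin\<bar> * \<bar>u t\<bar>))"
        using \<omega>(1) by (simp add: abs_mult)
      also have "\<dots> \<le> \<omega> * (1 * (2 * \<bar>Vin\<bar> * U))"
        using \<omega>(1) uU[of t] t by (intro mult_left_mono mult_mono) auto
      finally show "\<bar>- \<omega> * sin (\<omega> * (t - q)) * (2 * Vin * u t)\<bar> \<le> \<omega> * (2 * \<bar>Vin\<bar> * U)" by simp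
    qed (use pq assms(1) in auto)
    also have "\<dots> = (q - p) * (\<omega> * (2 * \<bar>Vin\<bar> * U))" using pq assms(1) by simp
    also have "\<dots> \<le> T * (\<omega> * (2 * \<bar>Vin\<bar> * U))"
      using pq assms(1) \<omega>(1) U0 by (intro mult_right_mono) auto
    finally have Fd: "\<bar>F q - F p\<bar> \<le> \<omega> * (2 * \<bar>Vin\<bar>) * T * U" by (simp add: ac_simps)
    have Fp: "F p = L1 * \<omega> * sin (\<omega> * (q - p)) * x p $ 1 + cos (\<omega> * (q - p)) * x p $ 3"
    proof -
      have "sin (\<omega> * (p - q)) = - sin (\<omega> * (q - p))" "cos (\<omega> * (p - q)) = cos (\<omega> * (q - p))"
        by (metis minus_diff_eq mult_minus_right sin_minus, metis minus_diff_eq mult_minus_right cos_minus)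
      then show ?thesis by (simp add: F_def)
    qed
    have Fq: "F q = x q $ 3" by (simp add: F_def)
    have "L1 * \<omega> * m * \<bar>x p $ 1\<bar> \<le> L1 * \<omega> * sin (\<omega> * (q - p)) * \<bar>x p $ 1\<bar>"
      unfolding m_def using s0(2)[of "q - p"] pq \<omega>(1) L1_pos by (intro mult_right_mono mult_left_mono) auto
    also have "\<dots> = \<bar>L1 * \<omega> * sin (\<omega> * (q - p)) * x p $ 1\<bar>"
    proof -
      have "0 \<le> sin (\<omega> * (q - p))"
        using m s0(2)[of "q - p"] pq by (simp add: m_def)
      then show ?thesis using \<omega>(1) L1_pos by (simp add: abs_mult)
    qed
    also have "\<dots> \<le> \<bar>F q - F p\<bar> + \<bar>x q $ 3\<bar> + \<bar>cos (\<omega> * (q - p)) * x p $ 3\<bar>"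
      unfolding Fp Fq by linarith
    also have "\<bar>cos (\<omega> * (q - p)) * x p $ 3\<bar> \<le> 1 * \<bar>x p $ 3\<bar>"
      unfolding abs_mult by (intro mult_right_mono) auto
    also note Fd
    also have "\<omega> * (2 * \<bar>Vin\<bar>) * T * U + \<bar>x q $ 3\<bar> + 1 * \<bar>x p $ 3\<bar> \<le> (1 + \<omega> * (2 * \<bar>Vin\<bar>) * T) * (\<bar>x p $ 3\<bar> + \<bar>x q $ 3\<bar> + U)"
    proof -
      have "0 \<le> \<omega> * (2 * \<bar>Vin\<bar>) * T * (\<bar>x p $ 3\<bar> + \<bar>x q $ 3\<bar>)"
        using \<omega>(1) T0 by simp
      then show ?thesis using U0 by (simp add: algebra_simps)
    qed
    finally show "\<bar>x p $ 1\<bar> \<le> ?C * (\<bar>x p $ 3\<bar> + \<bar>x q $ 3\<bar> + U)"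
      using \<omega>(1) m L1_pos by (simp add: pos_le_divide_eq mult.commute)
  qed
qed

section \<open>Contraction of the energy over two periods\<close>

text \<open>The whole state at the switching instant \<open>q\<close> is bounded through
  \<open>x\<^sub>4\<close> and the input, so its energy is at most a multiple of the dissipation
  \<open>J / R\<close> plus an input term. The final energy is at most 1 + \<eta> times the energy
  at \<open>q\<close>, up to input, while \<open>J / R\<close> is at most the loss of energy over
  the window, up to the growth and input terms. Eliminating \<open>J\<close> leaves the
  contraction.\<close>

lemma energy_contraction:
  assumes "0 < \<epsilon>" "2 * \<epsilon> \<le> T" "T < pi * sqrt (L1 * C1)"
  obtains \<gamma> c where "0 < \<gamma>" "\<gamma> < 1" "c \<ge> 0"
    "\<And>a q u x U. \<lbrakk>a + \<epsilon> \<le> q; q \<le> a + T - \<epsilon>; solution u x a (a + 2 * T);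
      \<And>t. a \<le> t \<Longrightarrow> t < q \<Longrightarrow> \<mu> t = 1/2; \<And>t. q \<le> t \<Longrightarrow> t < a + T \<Longrightarrow> \<mu> t = -1/2;
      \<And>t. a + T \<le> t \<Longrightarrow> t < a + T + \<epsilon> \<Longrightarrow> \<mu> t = 1/2;
      \<And>t. a \<le> t \<Longrightarrow> t \<le> a + 2 * T \<Longrightarrow> \<bar>u t\<bar> \<le> U\<rbrakk>
      \<Longrightarrow> energy (x (a + 2 * T)) \<le> \<gamma> * energy (x a) + c * U\<^sup>2"
proof -
  have T0: "T > 0" using assms by simp
  obtain Ca where Ca: "Ca > 0" "\<And>p u x U i. \<lbrakk>solution u x p (p + \<epsilon>); \<And>t. p \<le> t \<Longrightarrow> t < p + \<epsilon> \<Longrightarrow> \<mu> t = 1/2;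
      \<And>t. p \<le> t \<Longrightarrow> t \<le> p + \<epsilon> \<Longrightarrow> \<bar>u t\<bar> \<le> U; i \<in> {2, 3, 4}\<rbrakk>
      \<Longrightarrow> \<bar>x (p + \<epsilon>) $ i\<bar> \<le> Ca * (integral {p..p + \<epsilon>} (\<lambda>t. \<bar>x t $ 4\<bar>) + U)"
    using observability[OF assms(1), of \<epsilon>] by blast
  obtain Cb where Cb: "Cb > 0" "\<And>p u x U i. \<lbrakk>solution u x p (p + \<epsilon>); \<And>t. p \<le> t \<Longrightarrow> t < p + \<epsilon> \<Longrightarrow> \<mu> t = 1/2;
      \<And>t. p \<le> t \<Longrightarrow> t \<le> p + \<epsilon> \<Longrightarrow> \<bar>u t\<bar> \<le> U; i \<in> {2, 3, 4}\<rbrakk>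
      \<Longrightarrow> \<bar>x (p + 0) $ i\<bar> \<le> Cb * (integral {p..p + \<epsilon>} (\<lambda>t. \<bar>x t $ 4\<bar>) + U)"
    using observability[OF assms(1), of 0] by blast
  obtain Cc where Cc: "Cc > 0" "\<And>p q u x U. \<lbrakk>p + \<epsilon> \<le> q; q \<le> p + T - \<epsilon>; solution u x p q; \<And>t. p \<le> t \<Longrightarrow> t < q \<Longrightarrow> \<mu> t = -1/2;
      \<And>t. p \<le> t \<Longrightarrow> t \<le> q \<Longrightarrow> \<bar>u t\<bar> \<le> U\<rbrakk>
      \<Longrightarrow> \<bar>x p $ 1\<bar> \<le> Cc * (\<bar>x p $ 3\<bar> + \<bar>x q $ 3\<bar> + U)"
    using decoupled_oscillator_bound[OF assms] by blast
  \<comment> \<open>One constant for all four components at \<open>q\<close>: \<open>Ca\<close>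
    suffices for the observed three, the other summand is the oscillator bound for
    \<open>x\<^sub>1\<close>.\<close>
  define D where "D = Ca + Cc * (Ca + Cb + 1)"
  define M where "M = L1 + L2 + C1 + C2"
  \<comment> \<open>\<open>N\<close> and \<open>N1\<close> come from inserting
    \<open>W\<^sup>2 \<le> 6 * \<epsilon> * J + 3 * U\<^sup>2\<close> into
    \<open>M / 2 * D\<^sup>2 * W\<^sup>2\<close>; the factor \<open>R\<close> in \<open>N\<close>
    rescales \<open>J\<close> to the dissipated energy \<open>J / R\<close>.\<close>
  define N where "N = M * D\<^sup>2 * (3 * \<epsilon>) * R"
  define N1 where "N1 = M / 2 * D\<^sup>2 * 3"
  have D: "D > 0" using Ca Cb Cc by (simp add: D_def add_pos_pos)
  have M: "M > 0" using param_pos by (simp add: M_def)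
  have N: "N > 0" "N1 > 0" using D M assms(1) R_pos by (simp_all add: N_def N1_def)
  \<comment> \<open>Small enough for \<open>(1 + \<eta>)\<^sup>2 N < 1 + (1 + \<eta>) N\<close>, i.e. \<open>\<gamma> < 1\<close> below.\<close>
  define \<eta> where "\<eta> = 1 / (2 * (1 + N))"
  have \<eta>: "0 < \<eta>" "\<eta> \<le> 1" using N by (auto simp: \<eta>_def field_simps)
  have \<eta>N: "\<eta> * N \<le> 1 / 2" using N by (simp add: \<eta>_def field_simps)
  have "2 * T > 0" using T0 by simp
  obtain c where c: "c \<ge> 0" "\<And>a b u x U. \<lbrakk>a \<le> b; b - a \<le> 2 * T; solution u x a b; \<And>t. a \<le> t \<Longrightarrow> t \<le> b \<Longrightarrow> \<bar>u t\<bar> \<le> U\<rbrakk>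
     \<Longrightarrow> energy (x b) + integral {a..b} (\<lambda>t. (x t $ 4)\<^sup>2) / R \<le> (1 + \<eta>) * energy (x a) + c * U\<^sup>2"
    using energy_dissipation[OF \<open>2 * T > 0\<close> \<eta>] by blast
  \<comment> \<open>The coefficient of the final energy once the term
    \<open>(1 + \<eta>) * N\<close> times it has been moved to the left.\<close>
  define B where "B = 1 + (1 + \<eta>) * N"
  have B: "B > 1" using \<eta> N by (simp add: B_def)
  define \<gamma> where "\<gamma> = (1 + \<eta>)\<^sup>2 * N / B"
  define c' where "c' = ((1 + \<eta>) * N * c + (1 + \<eta>) * N1 + c) / B"
  show ?thesis
  proof (rule that[of \<gamma> c'])
    show "\<gamma> > 0" using \<eta> N B by (simp add: \<gamma>_def)
    show "c' \<ge> 0" using \<eta> N B c(1) by (simp add: c'_def)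
    have "(1 + \<eta>)\<^sup>2 * N = (1 + \<eta>) * N + (1 + \<eta>) * (\<eta> * N)"
      by (simp add: algebra_simps power2_eq_square)
    also have "(1 + \<eta>) * (\<eta> * N) \<le> (1 + 1/2) * (1/2)"
    proof (intro mult_mono)
      show "1 + \<eta> \<le> 1 + 1/2" using N by (simp add: \<eta>_def field_simps)
    qed (use \<eta> \<eta>N N in auto)
    finally show "\<gamma> < 1" using B by (simp add: \<gamma>_def B_def pos_divide_less_eq)
    fix a q u x U
    assume q: "a + \<epsilon> \<le> q" "q \<le> a + T - \<epsilon>" and sol: "solution u x a (a + 2 * T)"
      and m1: "\<And>t. a \<le> t \<Longrightarrow> t < q \<Longrightarrow> \<mu> t = 1/2" and m2: "\<And>t. q \<le> t \<Longrightarrow> t < a + T \<Longrightarrow> \<mu> t = -1/2"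
      and m3: "\<And>t. a + T \<le> t \<Longrightarrow> t < a + T + \<epsilon> \<Longrightarrow> \<mu> t = 1/2"
      and uU: "\<And>t. a \<le> t \<Longrightarrow> t \<le> a + 2 * T \<Longrightarrow> \<bar>u t\<bar> \<le> U"
    have U0: "U \<ge> 0" using uU[of a] T0 by auto
    define J where "J = integral {a..a + 2 * T} (\<lambda>t. (x t $ 4)\<^sup>2)"
    define Z1 where "Z1 = integral {q - \<epsilon>..q} (\<lambda>t. \<bar>x t $ 4\<bar>)"
    define Z2 where "Z2 = integral {a + T..a + T + \<epsilon>} (\<lambda>t. \<bar>x t $ 4\<bar>)"
    note x4c = solution_continuous_on(4)[OF sol]
    have Zabs: "0 \<le> integral {r..r + \<epsilon>} (\<lambda>t. \<bar>x t $ 4\<bar>)" and ZJ: "(integral {r..r + \<epsilon>} (\<lambda>t. \<bar>x t $ 4\<bar>))\<^sup>2 \<le> \<epsilon> * J"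
      if r: "a \<le> r" "r + \<epsilon> \<le> a + 2 * T" for r
    proof -
      have cr: "continuous_on {r..r + \<epsilon>} (\<lambda>t. x t $ 4)"
        by (rule continuous_on_subset[OF x4c]) (use r in auto)
      show "0 \<le> integral {r..r + \<epsilon>} (\<lambda>t. \<bar>x t $ 4\<bar>)"
        by (intro integral_nonneg integrable_continuous_interval continuous_intros cr) simp
      have "(integral {r..r + \<epsilon>} (\<lambda>t. \<bar>x t $ 4\<bar>))\<^sup>2 \<le> (r + \<epsilon> - r) * integral {r..r + \<epsilon>} (\<lambda>t. (x t $ 4)\<^sup>2)"
        by (rule integral_abs_power2_le[OF cr]) (use assms(1) in auto)
      also have "\<dots> \<le> (r + \<epsilon> - r) * J"
        unfolding J_def
        by (intro mult_left_mono integral_subset_le integrable_continuous_interval continuous_intros cr x4c)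
           (use r assms(1) in auto)
      finally show "(integral {r..r + \<epsilon>} (\<lambda>t. \<bar>x t $ 4\<bar>))\<^sup>2 \<le> \<epsilon> * J" by simp
    qed
    have Z: "0 \<le> Z1" "Z1\<^sup>2 \<le> \<epsilon> * J" "0 \<le> Z2" "Z2\<^sup>2 \<le> \<epsilon> * J"
      using Zabs[of "q - \<epsilon>"] ZJ[of "q - \<epsilon>"] Zabs[of "a + T"] ZJ[of "a + T"] q assms(1,2) by (simp_all add: Z1_def Z2_def)
    define W where "W = Z1 + Z2 + U"
    have W0: "W \<ge> 0" using Z U0 by (simp add: W_def)
    \<comment> \<open>Observability read at the right end of the last \<epsilon> before the switch,
      an interval that lies in mode 1/2 because \<open>a + \<epsilon> \<le> q\<close>.\<close>
    have xa: "\<bar>x q $ i\<bar> \<le> Ca * (Z1 + U)" if "i \<in> {2, 3, 4}" for i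
    proof -
      have s: "solution u x (q - \<epsilon>) (q - \<epsilon> + \<epsilon>)"
        by (rule solution_subinterval[OF sol]) (use q assms in auto)
      have "\<bar>x (q - \<epsilon> + \<epsilon>) $ i\<bar> \<le> Ca * (integral {q - \<epsilon>..q - \<epsilon> + \<epsilon>} (\<lambda>t. \<bar>x t $ 4\<bar>) + U)"
        by (rule Ca(2)[OF s _ _ that]) (use m1 uU q assms in auto)
      then show ?thesis by (simp add: Z1_def)
    qed
    have xb: "\<bar>x (a + T) $ 3\<bar> \<le> Cb * (Z2 + U)"
    proof -
      have s: "solution u x (a + T) (a + T + \<epsilon>)"
        by (rule solution_subinterval[OF sol]) (use q assms in auto)
      have "\<bar>x (a + T + 0) $ 3\<bar> \<le> Cb * (integral {a + T..a + T + \<epsilon>} (\<lambda>t. \<bar>x t $ 4\<bar>) + U)"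
        by (rule Cb(2)[OF s]) (use m3 uU q assms in auto)
      then show ?thesis by (simp add: Z2_def)
    qed
    have "\<bar>x q $ 1\<bar> \<le> Cc * (\<bar>x q $ 3\<bar> + \<bar>x (a + T) $ 3\<bar> + U)"
    proof -
      have s: "solution u x q (a + T)"
        by (rule solution_subinterval[OF sol]) (use q assms in auto)
      show ?thesis
        by (rule Cc(2)[OF _ _ s]) (use m2 uU q assms in auto)
    qed
    also have "\<dots> \<le> Cc * (Ca * W + Cb * W + 1 * W)"
    proof (intro mult_left_mono add_mono)
      show "\<bar>x q $ 3\<bar> \<le> Ca * W"
        by (rule order_trans[OF xa]) (use Ca Z U0 in \<open>auto simp: W_def\<close>)
      show "\<bar>x (a + T) $ 3\<bar> \<le> Cb * W"
        by (rule order_trans[OF xb]) (use Cb Z U0 in \<open>auto simp: W_def\<close>)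
      show "U \<le> 1 * W" using Z by (simp add: W_def)
    qed (use Cc in auto)
    also have "\<dots> \<le> D * W"
      unfolding D_def distrib_right using Ca W0 by (simp add: algebra_simps)
    finally have x1: "\<bar>x q $ 1\<bar> \<le> D * W" .
    have xi: "\<bar>x q $ i\<bar> \<le> D * W" if "i \<in> {2, 3, 4}" for i
    proof -
      have "Ca * (Z1 + U) \<le> D * W"
        using Ca Cb Cc Z U0 D by (intro mult_mono) (auto simp: D_def W_def)
      with xa[OF that] show ?thesis by simp
    qed
    have sq: "y\<^sup>2 \<le> (D * W)\<^sup>2" if "\<bar>y\<bar> \<le> D * W" for y
      using that abs_le_square_iff[of y "D * W"] D W0 by simp
    have W2: "W\<^sup>2 \<le> 6 * \<epsilon> * J + 3 * U\<^sup>2"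
    proof -
      \<comment> \<open>The squared differences encode that the square of a sum of three terms is at
        most three times the sum of their squares.\<close>
      have "0 \<le> (Z1 - Z2)\<^sup>2 + (Z1 - U)\<^sup>2 + (Z2 - U)\<^sup>2" by simp
      then have "W\<^sup>2 \<le> 3 * (Z1\<^sup>2 + Z2\<^sup>2 + U\<^sup>2)"
        by (simp add: W_def power2_eq_square algebra_simps)
      also have "\<dots> \<le> 3 * (\<epsilon> * J + \<epsilon> * J + U\<^sup>2)"
        using Z by (intro mult_left_mono add_mono) auto
      finally show ?thesis by (simp add: mult.commute mult.left_commute)
    qed
    have "energy (x q) \<le> (L1 * (D * W)\<^sup>2 + L2 * (D * W)\<^sup>2 + C1 * (D * W)\<^sup>2 + C2 * (D * W)\<^sup>2) / 2"
      unfolding energy_def using param_pos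
      by (intro divide_right_mono add_mono mult_left_mono sq x1 xi) auto
    also have "\<dots> = M / 2 * D\<^sup>2 * W\<^sup>2"
      by (simp add: M_def power_mult_distrib algebra_simps)
    also have "\<dots> \<le> M / 2 * D\<^sup>2 * (6 * \<epsilon> * J + 3 * U\<^sup>2)"
      using W2 M by (intro mult_left_mono) auto
    also have "\<dots> = N * (J / R) + N1 * U\<^sup>2"
      using R_pos by (simp add: N_def N1_def algebra_simps)
    finally have Eq: "energy (x q) \<le> N * (J / R) + N1 * U\<^sup>2" .
    let ?e = "a + 2 * T"
    have E1: "energy (x ?e) + J / R \<le> (1 + \<eta>) * energy (x a) + c * U\<^sup>2"
      unfolding J_def by (rule c(2)[OF _ _ sol]) (use uU T0 in auto)
    have E2: "energy (x ?e) \<le> (1 + \<eta>) * energy (x q) + c * U\<^sup>2"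
    proof -
      have s: "solution u x q ?e"
        by (rule solution_subinterval[OF sol]) (use q assms in auto)
      have "energy (x ?e) + integral {q..?e} (\<lambda>t. (x t $ 4)\<^sup>2) / R \<le> (1 + \<eta>) * energy (x q) + c * U\<^sup>2"
        by (rule c(2)[OF _ _ s]) (use uU q assms in auto)
      moreover have "0 \<le> integral {q..?e} (\<lambda>t. (x t $ 4)\<^sup>2) / R"
        using R_pos
        by (intro divide_nonneg_pos integral_nonneg integrable_continuous_interval continuous_intros solution_continuous_on(4)[OF s]) auto
      ultimately show ?thesis by linarith
    qed
    have "(1 + \<eta>) * energy (x q) \<le> (1 + \<eta>) * (N * (J / R) + N1 * U\<^sup>2)"
      using Eq \<eta> by (intro mult_left_mono) auto
    \<comment> \<open>\<open>E1\<close> solved for the dissipated energy; the final energy enters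
      with a negative sign, and this is the source of the contraction.\<close>
    moreover have "(1 + \<eta>) * N * (J / R) \<le> (1 + \<eta>) * N * ((1 + \<eta>) * energy (x a) + c * U\<^sup>2 - energy (x ?e))"
      using E1 \<eta> N by (intro mult_left_mono) auto
    ultimately have "energy (x ?e) \<le> (1 + \<eta>) * N * ((1 + \<eta>) * energy (x a) + c * U\<^sup>2 - energy (x ?e)) + (1 + \<eta>) * N1 * U\<^sup>2 + c * U\<^sup>2"
      using E2 by (simp add: distrib_left mult.assoc)
    then have "B * energy (x ?e) \<le> (1 + \<eta>)\<^sup>2 * N * energy (x a) + ((1 + \<eta>) * N * c + (1 + \<eta>) * N1 + c) * U\<^sup>2"
      unfolding B_def power2_eq_square by (simp add: algebra_simps)
    then have "energy (x ?e) \<le> ((1 + \<eta>)\<^sup>2 * N * energy (x a) + ((1 + \<eta>) * N * c + (1 + \<eta>) * N1 + c) * U\<^sup>2) / B"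
      using B by (simp add: pos_le_divide_eq mult.commute)
    then show "energy (x ?e) \<le> \<gamma> * energy (x a) + c' * U\<^sup>2"
      by (simp add: \<gamma>_def c'_def add_divide_distrib distrib_right)
  qed
qed

section \<open>From the contraction to exponential input-to-state stability\<close>

lemma norm_power2_4: "(norm (y :: real ^ 4))\<^sup>2 = (y $ 1)\<^sup>2 + (y $ 2)\<^sup>2 + (y $ 3)\<^sup>2 + (y $ 4)\<^sup>2"
  unfolding power2_norm_eq_inner inner_vec_def sum_4 by (simp add: power2_eq_square)

lemma energy_norm_bounds:
  obtains m M where "m > 0" "M > 0" "\<And>y. m * (norm y)\<^sup>2 \<le> energy y" "\<And>y. energy y \<le> M * (norm y)\<^sup>2"
proof
  let ?m = "min (min L1 L2) (min C1 C2) / 2" and ?M = "max (max L1 L2) (max C1 C2) / 2"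
  show "?m > 0" "?M > 0" using param_pos by auto
  fix y :: "real ^ 4"
  have "?m * (norm y)\<^sup>2 = (2 * ?m * (y $ 1)\<^sup>2 + 2 * ?m * (y $ 2)\<^sup>2 + 2 * ?m * (y $ 3)\<^sup>2 + 2 * ?m * (y $ 4)\<^sup>2) / 2"
    unfolding norm_power2_4 by (simp add: algebra_simps)
  also have "\<dots> \<le> energy y"
    unfolding energy_def by (intro divide_right_mono add_mono mult_right_mono) auto
  finally show "?m * (norm y)\<^sup>2 \<le> energy y" .
  have "energy y \<le> (2 * ?M * (y $ 1)\<^sup>2 + 2 * ?M * (y $ 2)\<^sup>2 + 2 * ?M * (y $ 3)\<^sup>2 + 2 * ?M * (y $ 4)\<^sup>2) / 2"
    unfolding energy_def by (intro divide_right_mono add_mono mult_right_mono) auto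
  also have "\<dots> = ?M * (norm y)\<^sup>2"
    unfolding norm_power2_4 by (simp add: algebra_simps)
  finally show "energy y \<le> ?M * (norm y)\<^sup>2" .
qed

text \<open>The contraction is iterated along multiples of 2 T, and a plain dissipation estimate
  covers the incomplete last window. The input bound is required on \<open>{0..t}\<close> only, so
  the estimate can be applied with the supremum up to the current time.\<close>

lemma input_to_state_stable:
  assumes "0 < \<epsilon>" "2 * \<epsilon> \<le> T" "T < pi * sqrt (L1 * C1)" "\<mu> \<in> PWM T \<epsilon>"
  obtains K lam G where "K > 0" "lam > 0" "G > 0"
    "\<And>u x U t. \<lbrakk>0 \<le> t; \<And>b. 0 \<le> b \<Longrightarrow> solution u x 0 b; \<And>\<tau>. 0 \<le> \<tau> \<Longrightarrow> \<tau> \<le> t \<Longrightarrow> \<bar>u \<tau>\<bar> \<le> U\<rbrakk>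
      \<Longrightarrow> norm (x t) \<le> K * norm (x 0) * exp (- lam * t) + G * U"
proof -
  have T0: "T > 0" "2 * T > 0" using assms by auto
  obtain \<gamma> c where \<gamma>: "0 < \<gamma>" "\<gamma> < 1" "c \<ge> 0" and contr:
    "\<And>a q u x U. \<lbrakk>a + \<epsilon> \<le> q; q \<le> a + T - \<epsilon>; solution u x a (a + 2 * T);
      \<And>t. a \<le> t \<Longrightarrow> t < q \<Longrightarrow> \<mu> t = 1/2; \<And>t. q \<le> t \<Longrightarrow> t < a + T \<Longrightarrow> \<mu> t = -1/2;
      \<And>t. a + T \<le> t \<Longrightarrow> t < a + T + \<epsilon> \<Longrightarrow> \<mu> t = 1/2;
      \<And>t. a \<le> t \<Longrightarrow> t \<le> a + 2 * T \<Longrightarrow> \<bar>u t\<bar> \<le> U\<rbrakk>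
      \<Longrightarrow> energy (x (a + 2 * T)) \<le> \<gamma> * energy (x a) + c * U\<^sup>2"
    using energy_contraction[OF assms(1-3)] by blast
  \<comment> \<open>In the incomplete window no contraction is sought, so \<eta> = 1 is good enough;
    the resulting factor 2 goes into \<open>K\<close>.\<close>
  obtain c1 where c1: "c1 \<ge> 0" "\<And>a b u x U. \<lbrakk>a \<le> b; b - a \<le> 2 * T; solution u x a b; \<And>t. a \<le> t \<Longrightarrow> t \<le> b \<Longrightarrow> \<bar>u t\<bar> \<le> U\<rbrakk>
     \<Longrightarrow> energy (x b) + integral {a..b} (\<lambda>t. (x t $ 4)\<^sup>2) / R \<le> 2 * energy (x a) + c1 * U\<^sup>2"
    using energy_dissipation[OF T0(2), of 1] by auto
  obtain m M where mM: "m > 0" "M > 0" "\<And>y. m * (norm y)\<^sup>2 \<le> energy y" "\<And>y. energy y \<le> M * (norm y)\<^sup>2"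
    using energy_norm_bounds by blast
  have period: "\<exists>q. of_int k * T + \<epsilon> \<le> q \<and> q \<le> (of_int k + 1) * T - \<epsilon> \<and>
      (\<forall>t. of_int k * T \<le> t \<and> t < q \<longrightarrow> \<mu> t = 1/2) \<and> (\<forall>t. q \<le> t \<and> t < (of_int k + 1) * T \<longrightarrow> \<mu> t = -1/2)" for k :: int
    using assms(4) unfolding PWM_def by blast
  \<comment> \<open>A factor \<gamma> per window of length 2 T is the rate
    \<open>- ln \<gamma> / (2 * T)\<close> for the energy, hence half of it for the norm.\<close>
  define lam where "lam = - ln \<gamma> / (4 * T)"
  define c2 where "c2 = 2 * c / (1 - \<gamma>) + c1"
  \<comment> \<open>2 pays for the incomplete window, 1 / \<gamma> for rounding the number of
    windows down, and M / m for passing between energy and norm.\<close>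
  define K where "K = sqrt (2 * M / (m * \<gamma>))"
  \<comment> \<open>The summand 1 keeps \<open>G\<close> positive even if \<open>c2\<close> is
    0.\<close>
  define G where "G = sqrt (c2 / m) + 1"
  have c2: "c2 \<ge> 0" using \<gamma> c1(1) by (simp add: c2_def)
  have K: "K > 0" "K\<^sup>2 = 2 * M / (m * \<gamma>)" using mM \<gamma> by (auto simp: K_def)
  have G: "G > 0" using c2 mM by (simp add: G_def add_nonneg_pos)
  have G2: "c2 / m \<le> G\<^sup>2"
  proof -
    have "c2 / m = (sqrt (c2 / m))\<^sup>2" using c2 mM by simp
    also have "\<dots> \<le> G\<^sup>2" unfolding G_def using c2 mM by (intro power_mono) auto
    finally show ?thesis .
  qed
  have lam: "lam > 0" using \<gamma> T0 unfolding lam_def by (intro divide_pos_pos) auto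
  show ?thesis
  proof (rule that[OF K(1) lam G])
    fix u x U t
    assume t: "0 \<le> t" and sol: "\<And>b. 0 \<le> b \<Longrightarrow> solution u x 0 b" and uU: "\<And>\<tau>. 0 \<le> \<tau> \<Longrightarrow> \<tau> \<le> t \<Longrightarrow> \<bar>u \<tau>\<bar> \<le> U"
    have U0: "U \<ge> 0" using uU[of 0] t by auto
    \<comment> \<open>\<open>c / (1 - \<gamma>)\<close> is the fixed point of
      \<open>v \<mapsto> \<gamma> * v + c\<close>, so the input term reproduces itself in the
      induction.\<close>
    have step: "energy (x (real n * (2 * T))) \<le> \<gamma> ^ n * energy (x 0) + c / (1 - \<gamma>) * U\<^sup>2"
      if "real n * (2 * T) \<le> t" for n
      using that
    proof (induction n)
      case 0
      then show ?case using \<gamma> by simp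
    next
      case (Suc n)
      let ?a = "real n * (2 * T)"
      have a0: "?a \<ge> 0" using T0 by simp
      have at: "?a + 2 * T \<le> t" using Suc.prems by (simp add: algebra_simps)
      \<comment> \<open>Window \<open>n\<close> consists of periods \<open>2 * n\<close> and
        \<open>2 * n + 1\<close>; of the second one only its opening stretch in mode 1/2 is
        used.\<close>
      obtain q where q: "?a + \<epsilon> \<le> q" "q \<le> ?a + T - \<epsilon>" "\<And>s. ?a \<le> s \<Longrightarrow> s < q \<Longrightarrow> \<mu> s = 1/2" "\<And>s. q \<le> s \<Longrightarrow> s < ?a + T \<Longrightarrow> \<mu> s = -1/2"
        using period[of "2 * int n"] by (auto simp: algebra_simps)
      obtain r where r: "?a + T + \<epsilon> \<le> r" "\<And>s. ?a + T \<le> s \<Longrightarrow> s < r \<Longrightarrow> \<mu> s = 1/2"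
        using period[of "2 * int n + 1"] by (auto simp: algebra_simps)
      have "energy (x (?a + 2 * T)) \<le> \<gamma> * energy (x ?a) + c * U\<^sup>2"
      proof (rule contr[OF q(1,2) _ q(3,4)])
        show "solution u x ?a (?a + 2 * T)"
          by (rule solution_subinterval[OF sol[of "?a + 2 * T"]]) (use a0 T0 in auto)
        show "\<bar>u s\<bar> \<le> U" if "?a \<le> s" "s \<le> ?a + 2 * T" for s
          using uU[of s] that a0 at by auto
        show "\<mu> s = 1/2" if "?a + T \<le> s" "s < ?a + T + \<epsilon>" for s
          using r that by auto
      qed
      also have "\<dots> \<le> \<gamma> * (\<gamma> ^ n * energy (x 0) + c / (1 - \<gamma>) * U\<^sup>2) + c * U\<^sup>2"
        using Suc.IH at T0 \<gamma> by (intro add_right_mono mult_left_mono) auto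
      also have "\<dots> = \<gamma> ^ Suc n * energy (x 0) + c / (1 - \<gamma>) * U\<^sup>2"
        using \<gamma> by (simp add: field_simps)
      finally show ?case by (simp add: algebra_simps)
    qed
    define n where "n = nat \<lfloor>t / (2 * T)\<rfloor>"
    have fl: "0 \<le> \<lfloor>t / (2 * T)\<rfloor>" using t T0 by simp
    have n: "real n \<le> t / (2 * T)" "t / (2 * T) < real n + 1"
      unfolding n_def using fl by (simp_all add: of_nat_nat)
    have nt: "real n * (2 * T) \<le> t" "t - real n * (2 * T) \<le> 2 * T"
      using n T0 by (auto simp: field_simps)
    let ?a = "real n * (2 * T)"
    have a0: "?a \<ge> 0" using T0 by simp
    have s: "solution u x ?a t"
      by (rule solution_subinterval[OF sol[OF t]]) (use a0 in auto)
    have "energy (x t) + integral {?a..t} (\<lambda>t. (x t $ 4)\<^sup>2) / R \<le> 2 * energy (x ?a) + c1 * U\<^sup>2"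
      by (rule c1(2)[OF nt s]) (rule uU, use a0 in linarith)
    moreover have "0 \<le> integral {?a..t} (\<lambda>t. (x t $ 4)\<^sup>2) / R"
      using R_pos
      by (intro divide_nonneg_pos integral_nonneg integrable_continuous_interval continuous_intros solution_continuous_on(4)[OF s]) auto
    ultimately have "energy (x t) \<le> 2 * energy (x ?a) + c1 * U\<^sup>2" by linarith
    also have "\<dots> \<le> 2 * (\<gamma> ^ n * energy (x 0) + c / (1 - \<gamma>) * U\<^sup>2) + c1 * U\<^sup>2"
      using step[OF nt(1)] by (intro add_right_mono mult_left_mono) auto
    also have "\<dots> = 2 * \<gamma> ^ n * energy (x 0) + c2 * U\<^sup>2" by (simp add: c2_def algebra_simps)
    also have "2 * \<gamma> ^ n * energy (x 0) \<le> 2 * (exp (- lam * t))\<^sup>2 / \<gamma> * (M * (norm (x 0))\<^sup>2)"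
    proof (intro mult_mono)
      \<comment> \<open>Since \<open>t / (2 * T)\<close> lies below \<open>n + 1\<close> and
        \<open>ln \<gamma>\<close> is negative, the power \<open>Suc n\<close> is the one that
        compares with the exponential; hence the division by \<gamma>.\<close>
      have "\<gamma> ^ Suc n = exp (real (Suc n) * ln \<gamma>)"
        using \<gamma>(1) by (metis exp_ln exp_of_nat_mult)
      also have "\<dots> \<le> exp (t / (2 * T) * ln \<gamma>)"
      proof -
        have "real (Suc n) * ln \<gamma> \<le> t / (2 * T) * ln \<gamma>"
          using n(2) \<gamma> by (intro mult_right_mono_neg) auto
        then show ?thesis by (simp only: exp_le_cancel_iff)
      qed
      also have "t / (2 * T) * ln \<gamma> = of_nat 2 * (- lam * t)"
        using T0 by (simp add: lam_def field_simps)
      also have "exp (of_nat 2 * (- lam * t)) = (exp (- lam * t))\<^sup>2" by (rule exp_of_nat_mult)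
      finally show "2 * \<gamma> ^ n \<le> 2 * (exp (- lam * t))\<^sup>2 / \<gamma>"
        using \<gamma> by (simp add: pos_le_divide_eq mult.commute)
    qed (use \<gamma> mM energy_nonneg in auto)
    finally have "m * (norm (x t))\<^sup>2 \<le> 2 * (exp (- lam * t))\<^sup>2 / \<gamma> * (M * (norm (x 0))\<^sup>2) + c2 * U\<^sup>2"
      using mM(3)[of "x t"] by simp
    then have "(norm (x t))\<^sup>2 \<le> (2 * (exp (- lam * t))\<^sup>2 / \<gamma> * (M * (norm (x 0))\<^sup>2) + c2 * U\<^sup>2) / m"
      using mM(1) by (simp add: pos_le_divide_eq mult.commute)
    also have "\<dots> = (K * norm (x 0) * exp (- lam * t))\<^sup>2 + c2 / m * U\<^sup>2"
      using mM \<gamma> by (simp add: K(2) power_mult_distrib field_simps)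
    also have "\<dots> \<le> (K * norm (x 0) * exp (- lam * t))\<^sup>2 + G\<^sup>2 * U\<^sup>2"
      using G2 by (intro add_left_mono mult_right_mono) auto
    also have "\<dots> \<le> (K * norm (x 0) * exp (- lam * t) + G * U)\<^sup>2"
      using K G U0 by (simp add: power2_sum power_mult_distrib)
    finally show "norm (x t) \<le> K * norm (x 0) * exp (- lam * t) + G * U"
      by (rule power2_le_imp_le) (use K G U0 in auto)
  qed
qed

end

section \<open>The switched model\<close>

text \<open>\<open>matrix_inv\<close> is defined by Hilbert choice, so \<open>N\<close> first
  witnesses that an inverse exists, and uniqueness then identifies the chosen one.\<close>

lemma matrix_inv_eqI:
  fixes M N :: "real ^ 'n ^ 'n"
  assumes "M ** N = mat 1" "N ** M = mat 1"
  shows "matrix_inv M = N"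
proof -
  have "M ** matrix_inv M = mat 1"
    unfolding matrix_inv_def using someI[of "\<lambda>N. M ** N = mat 1 \<and> N ** M = mat 1"] assms by blast
  then have "N ** (M ** matrix_inv M) = N" by simp
  then show ?thesis by (simp add: matrix_mul_assoc assms(2))
qed

lemma vector_4 [simp]:
  "(vector [a, b, c, d] :: 'a::zero ^ 4) $ 1 = a"
  "(vector [a, b, c, d] :: 'a::zero ^ 4) $ 2 = b"
  "(vector [a, b, c, d] :: 'a::zero ^ 4) $ 3 = c"
  "(vector [a, b, c, d] :: 'a::zero ^ 4) $ 4 = d"
  unfolding vector_def by simp_all

lemma matrix_inv_P_mat:
  assumes "L1 > 0" "L2 > 0" "C1 > 0" "C2 > 0"
  shows "matrix_inv (P_mat L1 L2 C1 C2) = diag_mat (vector [2 / L1, 2 / L2, 2 / C1, 2 / C2])"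
  by (rule matrix_inv_eqI)
     (use assms in \<open>simp_all add: P_mat_def diag_mat_def mat_def matrix_matrix_mult_def vec_eq_iff forall_4 sum_4\<close>)

lemma diag_mat_mult_vector: "(diag_mat v *v y) $ i = v $ i * y $ i" for v y :: "real ^ 'n"
  by (simp add: diag_mat_def matrix_vector_mult_def if_distrib[of "\<lambda>a. a * _"] cong: if_cong)

lemma (in inverter) trajectory_imp_solution:
  assumes "trajectory (\<lambda>t y. A_mat L1 L2 C1 C2 R (\<mu> t) *v y + u t *\<^sub>R B_vec L1 L2 C1 C2 Vin) x" "0 \<le> b"
  shows "solution u x 0 b"
proof -
  note inv = matrix_inv_P_mat[OF L1_pos L2_pos C1_pos C2_pos]
  have A: "(A_mat L1 L2 C1 C2 R m *v y) $ i =
     vector [1 / L1, 1 / L2, 1 / C1, 1 / C2] $ i * (((A0q R + m *\<^sub>R E0q) *v y) $ i)" for m y i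
    unfolding A_mat_def inv scaleR_matrix_vector_assoc[symmetric] matrix_vector_mul_assoc[symmetric]
    using exhaust_4[of i] by (auto simp: diag_mat_mult_vector)
  have B: "B_vec L1 L2 C1 C2 Vin $ i = vector [1 / L1, 1 / L2, 1 / C1, 1 / C2] $ i * vector [2 * Vin, 2 * Vin, 0, 0] $ i" for i
    unfolding B_vec_def inv using exhaust_4[of i] by (auto simp: diag_mat_mult_vector)
  have M: "((A0q R + m *\<^sub>R E0q) *v y) $ 1 = (m - 1/2) * y $ 3"
    "((A0q R + m *\<^sub>R E0q) *v y) $ 2 = (m + 1/2) * y $ 3 + y $ 4"
    "((A0q R + m *\<^sub>R E0q) *v y) $ 3 = (1/2 - m) * y $ 1 - (1/2 + m) * y $ 2"
    "((A0q R + m *\<^sub>R E0q) *v y) $ 4 = - y $ 2 - y $ 4 / R" for m y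
    by (simp_all add: matrix_vector_mult_def sum_4 A0q_def E0q_def algebra_simps)
  note tr = trajectory_imp_ac_deriv[OF assms(1) order.refl assms(2)]
  show ?thesis
    unfolding solution_def
    using ac_deriv_cong[OF tr[of 1]] ac_deriv_cong[OF tr[of 2]] ac_deriv_cong[OF tr[of 3]] ac_deriv_cong[OF tr[of 4]]
    by (simp add: A B M add_divide_distrib diff_divide_distrib)
qed

theorem theorem2:
  fixes L1 L2 C1 C2 R Vin T \<epsilon> :: real
    and A :: "real \<Rightarrow> real ^ 4 ^ 4" and B :: "real ^ 4" and \<mu> :: "real \<Rightarrow> real"
  defines "A \<equiv> A_mat L1 L2 C1 C2 R" and "B \<equiv> B_vec L1 L2 C1 C2 Vin"
  assumes "L1 > 0" "L2 > 0" "C1 > 0" "C2 > 0" "R > 0"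
    and "0 < 2 * \<epsilon>" "2 * \<epsilon> \<le> T" "T < pi * sqrt (L1 * C1)"
    and "\<mu> \<in> PWM T \<epsilon>"
  shows "(\<exists>K>0. \<exists>lam>0. \<forall>x. trajectory (\<lambda>t y. A (\<mu> t) *v y) x \<longrightarrow>
            (\<forall>t\<ge>0. norm (x t) \<le> K * norm (x 0) * exp (- lam * t)))
       \<and> (\<exists>K>0. \<exists>lam>0. \<exists>G>0.
            (\<forall>(u :: real \<Rightarrow> real) x. trajectory (\<lambda>t y. A (\<mu> t) *v y + u t *\<^sub>R B) x \<longrightarrow>
               (\<forall>t\<ge>0. ereal (norm (x t)) \<le>
                  ereal (K * norm (x 0) * exp (- lam * t)) + ereal G * (SUP \<tau>\<in>{0..t}. ereal (norm (u \<tau>)))))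
          \<and> (\<forall>x. trajectory (\<lambda>t y. A (\<mu> t) *v y + \<mu> t *\<^sub>R B) x \<longrightarrow>
               (\<forall>t\<ge>0. norm (x t) \<le> K * norm (x 0) * exp (- lam * t) + G / 2)))"
proof -
  interpret inverter L1 L2 C1 C2 R Vin \<mu>
    using assms by unfold_locales auto
  have "0 < \<epsilon>" using assms by simp
  obtain K lam G where pos: "K > 0" "lam > 0" "G > 0"
    and iss: "\<And>u x U t. \<lbrakk>0 \<le> t; \<And>b. 0 \<le> b \<Longrightarrow> solution u x 0 b; \<And>\<tau>. 0 \<le> \<tau> \<Longrightarrow> \<tau> \<le> t \<Longrightarrow> \<bar>u \<tau>\<bar> \<le> U\<rbrakk>
      \<Longrightarrow> norm (x t) \<le> K * norm (x 0) * exp (- lam * t) + G * U"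
    using input_to_state_stable[OF \<open>0 < \<epsilon>\<close> assms(9-11)] by blast
  have bound: "norm (x t) \<le> K * norm (x 0) * exp (- lam * t) + G * U"
    if "trajectory (\<lambda>t y. A (\<mu> t) *v y + u t *\<^sub>R B) x" "0 \<le> t" "\<And>\<tau>. 0 \<le> \<tau> \<Longrightarrow> \<tau> \<le> t \<Longrightarrow> \<bar>u \<tau>\<bar> \<le> U"
    for u x t U
    using that trajectory_imp_solution[of u x] unfolding A_def B_def by (intro iss) auto
  \<comment> \<open>The autonomous case is input 0 with bound 0, so the term with \<open>G\<close>
    drops out.\<close>
  have "norm (x t) \<le> K * norm (x 0) * exp (- lam * t)"
    if "trajectory (\<lambda>t y. A (\<mu> t) *v y) x" "0 \<le> t" for x t
    using bound[of "\<lambda>_. 0" x t 0] that by simp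
  moreover have "ereal (norm (x t)) \<le> ereal (K * norm (x 0) * exp (- lam * t)) + ereal G * (SUP \<tau>\<in>{0..t}. ereal (norm (u \<tau>)))"
    if tr: "trajectory (\<lambda>t y. A (\<mu> t) *v y + u t *\<^sub>R B) x" and t: "0 \<le> t" for u x t
  proof -
    let ?S = "SUP \<tau>\<in>{0..t}. ereal (norm (u \<tau>))"
    have le: "ereal \<bar>u \<tau>\<bar> \<le> ?S" if "0 \<le> \<tau>" "\<tau> \<le> t" for \<tau>
      using that SUP_upper[of \<tau> "{0..t}" "\<lambda>\<tau>. ereal (norm (u \<tau>))"] by simp
    have nonneg: "0 \<le> ?S" using le[of 0] t by (metis abs_ge_zero ereal_less_eq(5) order_refl order_trans)
    \<comment> \<open>The supremum is taken in the extended reals: it is infinite for an unbounded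
      input, where the claim is trivial because \<open>G > 0\<close>, and it cannot be negative
      because 0 lies in \<open>{0..t}\<close>.\<close>
    show ?thesis
    proof (cases ?S)
      case (real U)
      have "\<bar>u \<tau>\<bar> \<le> U" if "0 \<le> \<tau>" "\<tau> \<le> t" for \<tau>
        using le[OF that] real by simp
      from bound[OF tr t this] real show ?thesis by simp
    next
      case PInf
      then show ?thesis using pos by simp
    next
      case MInf
      then show ?thesis using nonneg by simp
    qed
  qed
  \<comment> \<open>The switching signal itself acts as the input, with bound 1/2; the constants are
    therefore those already obtained.\<close>
  moreover have "norm (x t) \<le> K * norm (x 0) * exp (- lam * t) + G / 2"
    if "trajectory (\<lambda>t y. A (\<mu> t) *v y + \<mu> t *\<^sub>R B) x" "0 \<le> t" for x t
  proof -
    have "\<bar>\<mu> \<tau>\<bar> \<le> 1/2" for \<tau>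
    proof -
      have "\<mu> \<tau> \<in> {-1/2, 1/2}" using assms(11) unfolding PWM_def by blast
      then show ?thesis by auto
    qed
    from bound[OF that this] show ?thesis by simp
  qed
  ultimately show ?thesis using pos by blast
qed

end
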